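(* Let $s,t\ge 2$ and $n\ge s+t+1$ be integers, and let $\ell_1,\ell_2$ be positive odd integers. Let $$R=\{\rho_0^2,\ \rho_1^2,\ \rho_2^2,\ (\rho_0\rho_1)^{2^s\ell_1},\ (\rho_1\rho_2)^{2^t\ell_2},\ (\rho_0\rho_2)^2,\ [(\rho_0\rho_1)^4,\rho_2],\ [\rho_0,(\rho_1\rho_2)^4]\}$$ and define the finitely presented group $$G=\begin{cases}\langle \rho_0,\rho_1,\rho_2 \mid R,\ [(\rho_0\rho_1)^2,\rho_2]^{2^{\frac{n-s-t-1}{2}}}\rangle, & n-s-t \text{ odd},\\[4pt] \langle \rho_0,\rho_1,\rho_2 \mid R,\ [(\rho_0\rho_1)^2,(\rho_1\rho_2)^2]^{2^{\frac{n-s-t-2}{2}}}\rangle, & n-s-t \text{ even}.\end{cases}$$ Then the group $G$ is solvable and the pair $(G,\{\rho_0,\rho_1,\rho_2\})$ is a string C-group of order $2^n\ell_1\ell_2$ with (Schläfli) type $\{2^s\ell_1,2^t\ell_2\}$.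
   Context: Commutators are $[x,y]=x^{-1}y^{-1}xy$. A string C-group of rank $3$ is a pair $(G,\{\rho_0,\rho_1,\rho_2\})$ where $G$ is a group generated by the ordered set of involutions $\rho_0,\rho_1,\rho_2$ such that $\rho_0\rho_2=\rho_2\rho_0$ (string property) and, writing $G_I=\langle \rho_i : i\in I\rangle$, one has $G_I\cap G_J=G_{I\cap J}$ for all $I,J\subseteq\{0,1,2\}$ (intersection property). Its order is $|G|$ and its (Schläfli) type is $\{o(\rho_0\rho_1),o(\rho_1\rho_2)\}$, an ordered pair, where $o(g)$ denotes the order of $g$. *)

theory Defs
  imports "HOL-Algebra.Solvable_Groups" "HOL-Algebra.Multiplicative_Group"
begin

section \<open>Free groups and group presentations\<close>

text \<open>A word is a list of signed letters; \<open>(True, x)\<close> stands for \<open>x\<close> and \<open>(False, x)\<close>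
  for the formal inverse of \<open>x\<close>.\<close>

type_synonym 'a word = "(bool \<times> 'a) list"

inductive_set free_rel :: "'a set \<Rightarrow> ('a word \<times> 'a word) set" for S where
  refl: "w \<in> lists (UNIV \<times> S) \<Longrightarrow> (w, w) \<in> free_rel S"
| sym: "(v, w) \<in> free_rel S \<Longrightarrow> (w, v) \<in> free_rel S"
| trans: "(u, v) \<in> free_rel S \<Longrightarrow> (v, w) \<in> free_rel S \<Longrightarrow> (u, w) \<in> free_rel S"
| cancel: "u \<in> lists (UNIV \<times> S) \<Longrightarrow> v \<in> lists (UNIV \<times> S) \<Longrightarrow> x \<in> S \<Longrightarrow>
    (u @ [(b, x), (\<not> b, x)] @ v, u @ v) \<in> free_rel S"

definition free_group :: "'a set \<Rightarrow> 'a word set monoid" where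
  "free_group S =
    \<lparr>carrier = lists (UNIV \<times> S) // free_rel S,
     mult = (\<lambda>A B. \<Union>u\<in>A. \<Union>v\<in>B. free_rel S `` {u @ v}),
     one = free_rel S `` {[]}\<rparr>"

definition free_gen :: "'a set \<Rightarrow> 'a \<Rightarrow> 'a word set" where
  "free_gen S x = free_rel S `` {[(True, x)]}"

definition normal_closure :: "('a, 'b) monoid_scheme \<Rightarrow> 'a set \<Rightarrow> 'a set" where
  "normal_closure G R = \<Inter>{N. N \<lhd> G \<and> R \<subseteq> N}"

definition presented_group :: "'a set \<Rightarrow> 'a word set set \<Rightarrow> 'a word set set monoid" where
  "presented_group S R = free_group S Mod normal_closure (free_group S) R"

definition presented_gen :: "'a set \<Rightarrow> 'a word set set \<Rightarrow> 'a \<Rightarrow> 'a word set set" where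
  "presented_gen S R x =
    normal_closure (free_group S) R #>\<^bsub>free_group S\<^esub> free_gen S x"

lemma free_rel_in_lists:
  "(v, w) \<in> free_rel S \<Longrightarrow> v \<in> lists (UNIV \<times> S) \<and> w \<in> lists (UNIV \<times> S)"
  by (induction rule: free_rel.induct) auto

lemma equiv_free_rel: "equiv (lists (UNIV \<times> S)) (free_rel S)"
proof (rule equivI)
  show "free_rel S \<subseteq> lists (UNIV \<times> S) \<times> lists (UNIV \<times> S)"
    by (rule subrelI, drule free_rel_in_lists) simp
  show "refl_on (lists (UNIV \<times> S)) (free_rel S)"
    by (intro refl_onI free_rel.refl)
  show "sym (free_rel S)"
    by (rule symI, rule free_rel.sym)
  show "trans (free_rel S)"
    by (rule transI, rule free_rel.trans)
qed

lemma free_rel_append_context: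
  assumes "(v, w) \<in> free_rel S" "a \<in> lists (UNIV \<times> S)" "b \<in> lists (UNIV \<times> S)"
  shows "(a @ v @ b, a @ w @ b) \<in> free_rel S"
  using assms
proof (induction rule: free_rel.induct)
  case (refl w)
  then show ?case by (simp add: free_rel.refl)
next
  case (sym v w)
  show ?case by (rule free_rel.sym[OF sym.IH[OF sym.prems]])
next
  case (trans u v w)
  show ?case by (rule free_rel.trans[OF trans.IH(1)[OF trans.prems] trans.IH(2)[OF trans.prems]])
next
  case (cancel u v x c)
  then show ?case
    using free_rel.cancel[of "a @ u" S "v @ b" x c] by simp
qed

lemma free_rel_append:
  assumes "(v, v') \<in> free_rel S" "(w, w') \<in> free_rel S"
  shows "(v @ w, v' @ w') \<in> free_rel S"
proof (rule free_rel.trans)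
  show "(v @ w, v' @ w) \<in> free_rel S"
    using free_rel_append_context[OF assms(1), of "[]" w] free_rel_in_lists[OF assms(2)] by simp
  show "(v' @ w, v' @ w') \<in> free_rel S"
    using free_rel_append_context[OF assms(2), of v' "[]"] free_rel_in_lists[OF assms(1)] by simp
qed

lemma free_group_mult:
  assumes "v \<in> lists (UNIV \<times> S)" "w \<in> lists (UNIV \<times> S)"
  shows "free_rel S `` {v} \<otimes>\<^bsub>free_group S\<^esub> free_rel S `` {w} = free_rel S `` {v @ w}"
proof -
  have "congruent2 (free_rel S) (free_rel S) (\<lambda>v w. free_rel S `` {v @ w})"
    by (rule congruent2I', rule equiv_class_eq[OF equiv_free_rel], rule free_rel_append)
  from UN_equiv_class2[OF equiv_free_rel equiv_free_rel this assms]
  show ?thesis by (simp add: free_group_def)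
qed

lemma inverse_word_in_lists:
  "w \<in> lists (UNIV \<times> S) \<Longrightarrow> rev (map (\<lambda>(b, x). (\<not> b, x)) w) \<in> lists (UNIV \<times> S)"
  by (induction w) auto

lemma free_rel_inverse:
  assumes "w \<in> lists (UNIV \<times> S)"
  shows "(rev (map (\<lambda>(b, x). (\<not> b, x)) w) @ w, []) \<in> free_rel S"
  using assms
proof (induction w rule: lists.induct)
  case Nil
  then show ?case by (simp add: free_rel.refl)
next
  case (Cons p w)
  obtain b x where p: "p = (b, x)" by (cases p)
  let ?i = "rev (map (\<lambda>(b, x). (\<not> b, x)) w)"
  have "?i \<in> lists (UNIV \<times> S)" using Cons.hyps(2) by (rule inverse_word_in_lists)
  then have "(?i @ [(\<not> b, x), (\<not> \<not> b, x)] @ w, ?i @ w) \<in> free_rel S"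
    using Cons.hyps p by (intro free_rel.cancel) auto
  moreover note Cons.IH
  ultimately have "(?i @ [(\<not> b, x), (\<not> \<not> b, x)] @ w, []) \<in> free_rel S"
    by (rule free_rel.trans)
  then show ?case using p by simp
qed

lemma free_group_carrierE:
  assumes "A \<in> carrier (free_group S)"
  obtains w where "w \<in> lists (UNIV \<times> S)" "A = free_rel S `` {w}"
  using assms by (auto simp: free_group_def quotient_def)

lemma free_group_carrierI:
  "w \<in> lists (UNIV \<times> S) \<Longrightarrow> free_rel S `` {w} \<in> carrier (free_group S)"
  by (simp add: free_group_def quotientI)

lemma free_group_one: "\<one>\<^bsub>free_group S\<^esub> = free_rel S `` {[]}"
  by (simp add: free_group_def)

lemma group_free_group: "group (free_group S)"
proof (rule groupI)
  fix A B assume "A \<in> carrier (free_group S)" "B \<in> carrier (free_group S)"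
  then show "A \<otimes>\<^bsub>free_group S\<^esub> B \<in> carrier (free_group S)"
    by (elim free_group_carrierE) (simp add: free_group_mult free_group_carrierI)
next
  show "\<one>\<^bsub>free_group S\<^esub> \<in> carrier (free_group S)"
    by (simp add: free_group_one free_group_carrierI)
next
  fix A B C
  assume "A \<in> carrier (free_group S)" "B \<in> carrier (free_group S)" "C \<in> carrier (free_group S)"
  then show "A \<otimes>\<^bsub>free_group S\<^esub> B \<otimes>\<^bsub>free_group S\<^esub> C =
      A \<otimes>\<^bsub>free_group S\<^esub> (B \<otimes>\<^bsub>free_group S\<^esub> C)"
    by (elim free_group_carrierE) (simp add: free_group_mult)
next
  fix A assume "A \<in> carrier (free_group S)"
  then show "\<one>\<^bsub>free_group S\<^esub> \<otimes>\<^bsub>free_group S\<^esub> A = A"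
    by (elim free_group_carrierE) (simp add: free_group_mult free_group_one)
next
  fix A assume "A \<in> carrier (free_group S)"
  then obtain w where w: "w \<in> lists (UNIV \<times> S)" "A = free_rel S `` {w}"
    by (rule free_group_carrierE)
  let ?i = "rev (map (\<lambda>(b, x). (\<not> b, x)) w)"
  have i: "?i \<in> lists (UNIV \<times> S)" using w(1) by (rule inverse_word_in_lists)
  have "free_rel S `` {?i} \<otimes>\<^bsub>free_group S\<^esub> A = \<one>\<^bsub>free_group S\<^esub>"
    unfolding w(2) free_group_mult[OF i w(1)] free_group_one
    by (intro equiv_class_eq[OF equiv_free_rel] free_rel_inverse w(1))
  with free_group_carrierI[OF i]
  show "\<exists>B\<in>carrier (free_group S). B \<otimes>\<^bsub>free_group S\<^esub> A = \<one>\<^bsub>free_group S\<^esub>"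
    by blast
qed

section \<open>Commutators and string C-groups of rank 3\<close>

definition commutator :: "('a, 'b) monoid_scheme \<Rightarrow> 'a \<Rightarrow> 'a \<Rightarrow> 'a" where
  "commutator G x y = inv\<^bsub>G\<^esub> x \<otimes>\<^bsub>G\<^esub> inv\<^bsub>G\<^esub> y \<otimes>\<^bsub>G\<^esub> x \<otimes>\<^bsub>G\<^esub> y"

text \<open>The ordered generating set is given as a function on the indices \<open>0, 1, 2\<close>. Its values are
  automatically distinct: by the intersection property, distinct generators generate subgroups
  that meet trivially.\<close>

definition string_C_group_rank3 :: "('a, 'b) monoid_scheme \<Rightarrow> (nat \<Rightarrow> 'a) \<Rightarrow> bool" where
  "string_C_group_rank3 G \<rho> \<longleftrightarrow>
    group G \<and>
    (\<forall>i\<in>{0, 1, 2}. \<rho> i \<in> carrier G \<and> group.ord G (\<rho> i) = 2) \<and>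
    generate G (\<rho> ` {0, 1, 2}) = carrier G \<and>
    \<rho> 0 \<otimes>\<^bsub>G\<^esub> \<rho> 2 = \<rho> 2 \<otimes>\<^bsub>G\<^esub> \<rho> 0 \<and>
    (\<forall>I J. I \<subseteq> {0, 1, 2} \<and> J \<subseteq> {0, 1, 2} \<longrightarrow>
      generate G (\<rho> ` I) \<inter> generate G (\<rho> ` J) = generate G (\<rho> ` (I \<inter> J)))"

definition schlafli_type :: "('a, 'b) monoid_scheme \<Rightarrow> (nat \<Rightarrow> 'a) \<Rightarrow> nat \<times> nat" where
  "schlafli_type G \<rho> =
    (group.ord G (\<rho> 0 \<otimes>\<^bsub>G\<^esub> \<rho> 1), group.ord G (\<rho> 1 \<otimes>\<^bsub>G\<^esub> \<rho> 2))"

section \<open>The family of presentations\<close>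

context
  fixes F :: "('a, 'b) monoid_scheme" (structure) and \<rho> :: "nat \<Rightarrow> 'a"
begin

definition common_relators :: "nat \<Rightarrow> nat \<Rightarrow> nat \<Rightarrow> nat \<Rightarrow> 'a set" where
  "common_relators s t l1 l2 =
    {\<rho> 0 [^] (2::nat), \<rho> 1 [^] (2::nat), \<rho> 2 [^] (2::nat),
     (\<rho> 0 \<otimes> \<rho> 1) [^] (2 ^ s * l1),
     (\<rho> 1 \<otimes> \<rho> 2) [^] (2 ^ t * l2),
     (\<rho> 0 \<otimes> \<rho> 2) [^] (2::nat),
     commutator F ((\<rho> 0 \<otimes> \<rho> 1) [^] (4::nat)) (\<rho> 2),
     commutator F (\<rho> 0) ((\<rho> 1 \<otimes> \<rho> 2) [^] (4::nat))}"

text \<open>The subtractions and divisions below are exact whenever \<open>s + t + 1 \<le> n\<close>.\<close>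

definition extra_relator :: "nat \<Rightarrow> nat \<Rightarrow> nat \<Rightarrow> 'a" where
  "extra_relator s t n =
    (if odd (n - s - t)
     then commutator F ((\<rho> 0 \<otimes> \<rho> 1) [^] (2::nat)) (\<rho> 2)
            [^] ((2::nat) ^ ((n - s - t - 1) div 2))
     else commutator F ((\<rho> 0 \<otimes> \<rho> 1) [^] (2::nat)) ((\<rho> 1 \<otimes> \<rho> 2) [^] (2::nat))
            [^] ((2::nat) ^ ((n - s - t - 2) div 2)))"

end

definition relators :: "nat \<Rightarrow> nat \<Rightarrow> nat \<Rightarrow> nat \<Rightarrow> nat \<Rightarrow> nat word set set" where
  "relators s t n l1 l2 =
    (let F = free_group {0, 1, 2}; \<rho> = free_gen {0, 1, 2} in
      common_relators F \<rho> s t l1 l2 \<union> {extra_relator F \<rho> s t n})"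

end

theory Submission
  imports Defs "HOL-Algebra.Bij"
begin

text \<open>
  Write \<open>a, b, c\<close> for the generators. Since \<open>c\<close> commutes with \<open>p = (ab)\<^sup>4\<close> and \<open>a\<close> with
  \<open>q = (bc)\<^sup>4\<close>, every generator conjugates each of \<open>p\<close>, \<open>q\<close> to itself or to its inverse, so
  \<open>N = \<langle>p, q\<rangle>\<close> is normal and abelian. The quotient by \<open>N\<close> is a quotient of the Coxeter group
  \<open>[4,4]\<close> of the square tessellation: there \<open>abcb\<close> and \<open>babc\<close> are commuting translations generating a
  normal subgroup \<open>L\<close>, the point group is dihedral of order \<open>8\<close>, and the extra relator becomes
  \<open>(babc)\<^sup>m\<close> or \<open>(abcb\<cdot>babc)\<^sup>m\<close> for a power \<open>m\<close> of \<open>2\<close>. This gives solvability and a normal form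
  \<open>p\<^sup>i q\<^sup>j l d\<close> with \<open>l \<in> L\<close> and \<open>d\<close> in the point group. Its uniqueness, and the
  orders of \<open>ab\<close> and \<open>bc\<close>, are read off from explicit quotients: the point group, the group of a torus
  acting on pairs of complex numbers, and the dihedral groups obtained by killing \<open>c\<close> or \<open>a\<close>.
  All relators are trivial in the elementary abelian group of order \<open>8\<close>; this parity argument reduces the
  intersection property to \<open>\<langle>a, b\<rangle> \<inter> \<langle>b, c\<rangle> = \<langle>b\<rangle>\<close>, which follows from the dihedral quotient killing
  \<open>c\<close>, because \<open>\<langle>a, b\<rangle>\<close> embeds in it.
\<close>

section \<open>The universal property of a presented group\<close>

definition word_eval :: "('b, 'c) monoid_scheme \<Rightarrow> ('a \<Rightarrow> 'b) \<Rightarrow> 'a word \<Rightarrow> 'b" where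
  "word_eval H f w =
    foldr (\<lambda>(e, x) z. (if e then f x else inv\<^bsub>H\<^esub> f x) \<otimes>\<^bsub>H\<^esub> z) w \<one>\<^bsub>H\<^esub>"

context group
begin

lemma word_eval_Nil [simp]: "word_eval G f [] = \<one>"
  by (simp add: word_eval_def)

lemma word_eval_Cons [simp]:
  "word_eval G f ((e, x) # w) = (if e then f x else inv f x) \<otimes> word_eval G f w"
  by (simp add: word_eval_def)

lemma word_eval_closed:
  assumes "f \<in> S \<rightarrow> carrier G" "w \<in> lists (UNIV \<times> S)"
  shows "word_eval G f w \<in> carrier G"
  using assms(2)
proof (induction w)
  case (Cons p w)
  obtain e x where "p = (e, x)" by (cases p)
  with Cons assms(1) show ?case by (auto simp: Pi_iff)
qed simp

lemma word_eval_append: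
  assumes f: "f \<in> S \<rightarrow> carrier G" and v: "v \<in> lists (UNIV \<times> S)" and w: "w \<in> lists (UNIV \<times> S)"
  shows "word_eval G f (v @ w) = word_eval G f v \<otimes> word_eval G f w"
  using v
proof (induction v)
  case Nil
  then show ?case by (simp add: word_eval_closed[OF f w])
next
  case (Cons p v)
  obtain e x where "p = (e, x)" by (cases p)
  with Cons f show ?case
    by (auto simp: Pi_iff m_assoc word_eval_closed[OF f] w)
qed

text \<open>A cancelling pair evaluates to \<open>\<one>\<close>, so evaluation is constant on the
  classes of \<open>free_rel\<close> and descends to the free group.\<close>

lemma word_eval_free_rel:
  assumes f: "f \<in> S \<rightarrow> carrier G" and "(v, w) \<in> free_rel S"
  shows "word_eval G f v = word_eval G f w"
  using assms(2)
proof (induction rule: free_rel.induct)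
  case (cancel u v x e)
  have fx: "f x \<in> carrier G" using f cancel by auto
  have v: "word_eval G f v \<in> carrier G" by (rule word_eval_closed[OF f cancel(2)])
  have "word_eval G f ([(e, x), (\<not> e, x)] @ v) = word_eval G f v"
    using fx v by (cases e) (simp_all add: m_assoc[symmetric])
  moreover have "[(e, x), (\<not> e, x)] @ v \<in> lists (UNIV \<times> S)"
    using cancel by simp
  ultimately show ?case
    using cancel by (simp add: word_eval_append[OF f] del: append_Cons)
qed auto

lemma free_group_hom:
  assumes f: "f \<in> S \<rightarrow> carrier G"
  obtains h where "h \<in> hom (free_group S) G" "\<And>x. x \<in> S \<Longrightarrow> h (free_gen S x) = f x"
proof -
  \<comment> \<open>An element of the free group is a class of words, and all its representatives
    have the same value, so the choice is harmless.\<close>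
  define h where "h A = word_eval G f (SOME w. w \<in> A)" for A
  have h: "h (free_rel S `` {w}) = word_eval G f w" if "w \<in> lists (UNIV \<times> S)" for w
  proof -
    have "w \<in> free_rel S `` {w}" using that by (simp add: free_rel.refl)
    then have "(SOME v. v \<in> free_rel S `` {w}) \<in> free_rel S `` {w}" by (rule someI)
    then show ?thesis unfolding h_def using word_eval_free_rel[OF f] by (metis Image_singleton_iff)
  qed
  show thesis
  proof
    show "h \<in> hom (free_group S) G"
    proof (rule homI)
      fix A assume "A \<in> carrier (free_group S)"
      then show "h A \<in> carrier G"
        by (elim free_group_carrierE) (simp add: h word_eval_closed[OF f])
    next
      fix A B assume "A \<in> carrier (free_group S)" "B \<in> carrier (free_group S)"
      then show "h (A \<otimes>\<^bsub>free_group S\<^esub> B) = h A \<otimes> h B"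
        by (elim free_group_carrierE) (simp add: h word_eval_append[OF f] free_group_mult)
    qed
    show "h (free_gen S x) = f x" if "x \<in> S" for x
      using that f by (auto simp: free_gen_def h Pi_iff)
  qed
qed

section \<open>Normal closures and generation of the free group\<close>

lemma normal_closure_normal:
  assumes "R \<subseteq> carrier G"
  shows "normal_closure G R \<lhd> G"
proof (rule normal_invI)
  show "subgroup (normal_closure G R) G"
    unfolding normal_closure_def
    \<comment> \<open>The intersection runs over a nonempty family, since the whole group contains
      \<open>R\<close>.\<close>
    by (rule subgroups_Inter) (use assms normal_self in \<open>auto intro: normal_imp_subgroup\<close>)
  show "\<And>x h. x \<in> carrier G \<Longrightarrow> h \<in> normal_closure G R \<Longrightarrow>
      x \<otimes> h \<otimes> inv x \<in> normal_closure G R"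
    unfolding normal_closure_def by (auto intro: normal_invE(2))
qed

lemma subset_normal_closure: "R \<subseteq> normal_closure G R"
  by (auto simp: normal_closure_def)

lemma normal_closure_subset:
  assumes "N \<lhd> G" "R \<subseteq> N"
  shows "normal_closure G R \<subseteq> N"
  using assms by (auto simp: normal_closure_def)

end

lemma free_gen_closed [simp]: "x \<in> S \<Longrightarrow> free_gen S x \<in> carrier (free_group S)"
  by (simp add: free_gen_def free_group_carrierI)

text \<open>A word is the product of its letters, and the class of the letter
  \<open>(False, x)\<close> is the inverse of \<open>free_gen S x\<close>.\<close>

lemma generate_free_gen: "generate (free_group S) (free_gen S ` S) = carrier (free_group S)"
proof
  interpret F: group "free_group S" by (rule group_free_group)
  have sub: "free_gen S ` S \<subseteq> carrier (free_group S)" by auto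
  show "generate (free_group S) (free_gen S ` S) \<subseteq> carrier (free_group S)"
    by (rule F.generate_incl[OF sub])
  have "free_rel S `` {w} \<in> generate (free_group S) (free_gen S ` S)"
    if "w \<in> lists (UNIV \<times> S)" for w
    using that
  proof (induction w)
    case Nil
    then show ?case
      using generate.one[of "free_group S"] by (simp add: free_group_one)
  next
    case (Cons p w)
    obtain e x where p: "p = (e, x)" by (cases p)
    have x: "x \<in> S" using Cons p by auto
    have inv: "free_rel S `` {[(False, x)]} = inv\<^bsub>free_group S\<^esub> free_gen S x"
    proof (rule F.inv_equality[symmetric])
      have "([(False, x), (\<not> False, x)] @ [], []) \<in> free_rel S"
        using free_rel.cancel[of "[]" S "[]" x False] x by simp
      then show "free_rel S `` {[(False, x)]} \<otimes>\<^bsub>free_group S\<^esub> free_gen S x = \<one>\<^bsub>free_group S\<^esub>"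
        using x equiv_class_eq[OF equiv_free_rel]
        by (simp add: free_gen_def free_group_mult free_group_one)
    qed (use x in \<open>simp_all add: free_group_carrierI\<close>)
    have "free_rel S `` {[p]} \<in> generate (free_group S) (free_gen S ` S)"
      using x generate.incl[of _ "free_gen S ` S"] generate.inv[of _ "free_gen S ` S" "free_group S"]
      by (cases e) (auto simp: p inv free_gen_def[symmetric])
    moreover have "free_rel S `` {p # w} = free_rel S `` {[p]} \<otimes>\<^bsub>free_group S\<^esub> free_rel S `` {w}"
      using Cons x by (subst free_group_mult) (auto simp: p)
    ultimately show ?case using Cons by (simp add: generate.eng)
  qed
  then show "carrier (free_group S) \<subseteq> generate (free_group S) (free_gen S ` S)"
    by (auto elim!: free_group_carrierE)
qed

section \<open>Presented groups and von Dyck's theorem\<close>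

context
  fixes S :: "'a set" and R :: "'a word set set"
  assumes R: "R \<subseteq> carrier (free_group S)"
begin

lemma presented_normal: "normal_closure (free_group S) R \<lhd> free_group S"
  using group.normal_closure_normal[OF group_free_group R] .

lemma group_presented_group: "group (presented_group S R)"
  unfolding presented_group_def by (rule normal.factorgroup_is_group[OF presented_normal])

lemma presented_group_proj:
  obtains h where "h \<in> hom (free_group S) (presented_group S R)"
    "h ` carrier (free_group S) = carrier (presented_group S R)"
    "\<And>x. h (free_gen S x) = presented_gen S R x"
    "\<And>r. r \<in> R \<Longrightarrow> h r = \<one>\<^bsub>presented_group S R\<^esub>"
proof
  let ?F = "free_group S" and ?N = "normal_closure (free_group S) R"
  interpret N: normal ?N ?F by (rule presented_normal)
  show "(#>\<^bsub>?F\<^esub>) ?N \<in> hom ?F (presented_group S R)"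
    unfolding presented_group_def by (rule N.r_coset_hom_Mod)
  show "(#>\<^bsub>?F\<^esub>) ?N ` carrier ?F = carrier (presented_group S R)"
    unfolding presented_group_def FactGroup_def RCOSETS_def by auto
  show "?N #>\<^bsub>?F\<^esub> free_gen S x = presented_gen S R x" for x
    by (simp add: presented_gen_def)
  show "?N #>\<^bsub>?F\<^esub> r = \<one>\<^bsub>presented_group S R\<^esub>" if "r \<in> R" for r
    using that N.subset_normal_closure[of R] N.rcos_const[of r]
    by (auto simp: presented_group_def FactGroup_def)
qed

lemma generate_presented_gen:
  "generate (presented_group S R) (presented_gen S R ` S) = carrier (presented_group S R)"
proof -
  obtain h where h: "h \<in> hom (free_group S) (presented_group S R)"
    "h ` carrier (free_group S) = carrier (presented_group S R)"
    "\<And>x. h (free_gen S x) = presented_gen S R x"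
    using presented_group_proj by metis
  interpret group_hom "free_group S" "presented_group S R" h
    by (intro group_hom.intro group_free_group group_presented_group group_hom_axioms.intro h(1))
  have sub: "free_gen S ` S \<subseteq> carrier (free_group S)" by auto
  have "presented_gen S R ` S = h ` free_gen S ` S" by (simp add: h(3) image_image)
  then show ?thesis
    using generate_img[OF sub] generate_free_gen[of S] h(2) by simp
qed

text \<open>Von Dyck's theorem: the relators lie in the kernel of the map from the free group, and
  so does their normal closure. The extension of \<open>f\<close> to the free group is obtained only
  existentially, hence \<open>rel\<close> speaks of every such extension.\<close>

lemma presented_group_hom:
  assumes H: "group H" and f: "f \<in> S \<rightarrow> carrier H"
    and rel: "\<And>h. h \<in> hom (free_group S) H \<Longrightarrow> (\<And>x. x \<in> S \<Longrightarrow> h (free_gen S x) = f x) \<Longrightarrow>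
      h ` R \<subseteq> {\<one>\<^bsub>H\<^esub>}"
  obtains g where "g \<in> hom (presented_group S R) H"
    "\<And>x. x \<in> S \<Longrightarrow> g (presented_gen S R x) = f x"
proof -
  obtain h where h: "h \<in> hom (free_group S) H" "\<And>x. x \<in> S \<Longrightarrow> h (free_gen S x) = f x"
    using group.free_group_hom[OF H f] by blast
  interpret group_hom "free_group S" H h
    by (intro group_hom.intro group_free_group H group_hom_axioms.intro h(1))
  have "R \<subseteq> kernel (free_group S) H h"
    using rel[OF h] R by (auto simp: kernel_def)
  then have "normal_closure (free_group S) R \<subseteq> kernel (free_group S) H h"
    by (rule G.normal_closure_subset[OF normal_kernel])
  then obtain g where "g \<in> hom (free_group S Mod normal_closure (free_group S) R) H"
    "\<And>x. x \<in> carrier (free_group S) \<Longrightarrow>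
      g (normal_closure (free_group S) R #>\<^bsub>free_group S\<^esub> x) = h x"
    using FactGroup_universal_kernel[OF presented_normal] by blast
  then show thesis
    using that[of g] h(2) by (simp add: presented_group_def presented_gen_def)
qed

end

section \<open>Groups generated by one or two elements, and solvability\<close>

context group
begin

lemma inv_eq_pow_of_finite_order:
  assumes "x \<in> carrier G" "x [^] (n::nat) = \<one>" "n > 0"
  shows "inv x = x [^] (n - 1)"
proof (rule inv_equality)
  show "x [^] (n - 1) \<otimes> x = \<one>"
    using assms nat_pow_Suc[of x "n - 1"] by simp
qed (use assms in auto)

lemma nat_pow_mod_exponent:
  assumes "x \<in> carrier G" "x [^] (n::nat) = \<one>"
  shows "x [^] (i mod n) = x [^] i"
proof -
  have "x [^] i = x [^] (n * (i div n) + i mod n)" by simp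
  also have "\<dots> = x [^] (i mod n)"
    using assms by (simp only: nat_pow_mult[symmetric] nat_pow_pow[symmetric]) simp
  finally show ?thesis by simp
qed

text \<open>When inverses of generators are powers, every element is a product of generators alone,
  so the induction may add one generator on the left.\<close>

lemma generate_left_induct [consumes 2, case_names inv one mult]:
  assumes g: "g \<in> generate G S" and S: "S \<subseteq> carrier G"
    and inv: "\<And>s. s \<in> S \<Longrightarrow> \<exists>n::nat. inv s = s [^] n"
    and one: "P \<one>"
    and mult: "\<And>s h. s \<in> S \<Longrightarrow> h \<in> carrier G \<Longrightarrow> P h \<Longrightarrow> P (s \<otimes> h)"
  shows "P g"
proof -
  have pow: "P (s [^] (n::nat) \<otimes> h)" if "s \<in> S" "h \<in> carrier G" "P h" for s h n
    using that(2,3)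
  proof (induction n arbitrary: h)
    case (Suc n)
    have s: "s \<in> carrier G" using that(1) S by auto
    have "P (s [^] n \<otimes> (s \<otimes> h))" using Suc s mult[OF that(1)] by simp
    then show ?case using s Suc by (simp add: m_assoc)
  qed simp
  \<comment> \<open>Strengthened by an arbitrary right factor \<open>h\<close>, so that a product
    \<open>g1 \<otimes> g2\<close> is absorbed one factor at a time.\<close>
  have "P (g \<otimes> h)" if "h \<in> carrier G" "P h" for h
    using g that
  proof (induction arbitrary: h)
    case (inv s)
    then show ?case using assms(3)[OF inv(1)] pow by metis
  next
    case (eng g1 g2)
    then show ?case using generate_in_carrier[OF S] by (simp add: m_assoc)
  qed (use mult in auto)
  from this[OF one_closed one] show ?thesis using generate_in_carrier[OF S g] by simp
qed

section \<open>Normal forms in groups generated by two elements\<close>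

lemma commuting_pow:
  assumes "u \<in> carrier G" "v \<in> carrier G" "v \<otimes> u = u \<otimes> v"
  shows "v \<otimes> u [^] (i::nat) = u [^] i \<otimes> v"
  using assms by (induction i) (simp_all add: m_assoc[symmetric], simp add: m_assoc)

text \<open>Left multiplication by \<open>u\<close> or \<open>v\<close> raises one exponent of such
  a product; the finite exponents \<open>M\<close> and \<open>N\<close> turn inverses into powers
  and allow a final reduction modulo \<open>M\<close> and \<open>N\<close>.\<close>

lemma generate_commuting_pair:
  assumes u: "u \<in> carrier G" and v: "v \<in> carrier G" and comm: "v \<otimes> u = u \<otimes> v"
    and M: "u [^] (M::nat) = \<one>" "M > 0" and N: "v [^] (N::nat) = \<one>" "N > 0"
    and g: "g \<in> generate G {u, v}"
  obtains i j where "i < M" "j < N" "g = u [^] i \<otimes> v [^] j"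
proof -
  have sub: "{u, v} \<subseteq> carrier G" using u v by simp
  have "\<exists>i j. g = u [^] (i::nat) \<otimes> v [^] (j::nat)"
    using g sub
  proof (induction rule: generate_left_induct)
    case (inv s)
    then show ?case using inv_eq_pow_of_finite_order u v M N by blast
  next
    case one
    show ?case by (rule exI[of _ 0], rule exI[of _ 0]) simp
  next
    case (mult s h)
    then obtain i j where h: "h = u [^] (i::nat) \<otimes> v [^] (j::nat)" by blast
    have "u \<otimes> h = u [^] Suc i \<otimes> v [^] j"
      unfolding h nat_pow_Suc2[OF u] using u v by (simp add: m_assoc)
    moreover have "v \<otimes> h = u [^] i \<otimes> v [^] Suc j"
      unfolding h nat_pow_Suc2[OF v] using u v commuting_pow[OF u v comm, of i]
      by (simp add: m_assoc[symmetric])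
    ultimately show ?case using mult(1) by blast
  qed
  then obtain i j where "g = u [^] (i::nat) \<otimes> v [^] (j::nat)" by blast
  then have "g = u [^] (i mod M) \<otimes> v [^] (j mod N)"
    using nat_pow_mod_exponent[OF u M(1)] nat_pow_mod_exponent[OF v N(1)] by simp
  then show thesis using that[of "i mod M" "j mod N"] M N by simp
qed

text \<open>Dihedral normal form: \<open>b\<close> inverts the rotation
  \<open>a \<otimes> b\<close>, so left multiplication by \<open>b\<close> negates its exponent, and
  \<open>a\<close> is the rotation times \<open>b\<close>.\<close>

lemma generate_involution_pair:
  assumes a: "a \<in> carrier G" and b: "b \<in> carrier G" and aa: "a \<otimes> a = \<one>" and bb: "b \<otimes> b = \<one>"
    and M: "(a \<otimes> b) [^] (M::nat) = \<one>" "M > 0"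
    and g: "g \<in> generate G {a, b}"
  obtains i e where "i < M" "e < 2" "g = (a \<otimes> b) [^] i \<otimes> b [^] (e::nat)"
proof -
  let ?x = "a \<otimes> b"
  have ia: "inv a = a" and ib: "inv b = b" using a b aa bb by (auto intro: inv_equality)
  have x: "?x \<in> carrier G" using a b by simp
  have inv_x: "inv ?x = ?x [^] (M - 1)" by (rule inv_eq_pow_of_finite_order[OF x M])
  have "b \<otimes> ?x = inv ?x \<otimes> b" using a b by (simp add: inv_mult_group ia ib m_assoc)
  then have bx: "b \<otimes> ?x [^] i = inv ?x [^] i \<otimes> b" for i :: nat
  proof (induction i)
    case (Suc i)
    have "b \<otimes> ?x [^] Suc i = (b \<otimes> ?x [^] i) \<otimes> ?x" using x b by (simp add: m_assoc)
    also have "\<dots> = inv ?x [^] i \<otimes> (b \<otimes> ?x)" using Suc x b by (simp add: m_assoc)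
    also have "\<dots> = inv ?x [^] Suc i \<otimes> b" using Suc.prems x b by (simp add: m_assoc)
    finally show ?case .
  qed (use b in simp)
  have b2: "b [^] (2::nat) = \<one>" using b bb by (simp add: numeral_2_eq_2)
  have sub: "{a, b} \<subseteq> carrier G" using a b by simp
  have "\<exists>i e. g = ?x [^] (i::nat) \<otimes> b [^] (e::nat)"
    using g sub
  proof (induction rule: generate_left_induct)
    case (inv s)
    then show ?case using ia ib a b nat_pow_eone by (metis insertE singletonD)
  next
    case one
    show ?case by (rule exI[of _ 0], rule exI[of _ 0]) simp
  next
    case (mult s h)
    then obtain i e where h: "h = ?x [^] (i::nat) \<otimes> b [^] (e::nat)" by blast
    \<comment> \<open>The exponent \<open>(M - 1) * i\<close> stands for \<open>- i\<close>, since
      the inverse of the rotation is its power \<open>M - 1\<close>.\<close>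
    have bh: "b \<otimes> h = ?x [^] ((M - 1) * i) \<otimes> b [^] Suc e"
      unfolding h nat_pow_Suc2[OF b] using bx[of i] x b inv_x
      by (simp add: m_assoc[symmetric] nat_pow_pow)
    moreover have "a \<otimes> h = ?x [^] Suc ((M - 1) * i) \<otimes> b [^] Suc e"
    proof -
      have "b \<otimes> (b \<otimes> h) = h" using mult(2) b bb by (simp add: m_assoc[symmetric])
      then have "a \<otimes> h = ?x \<otimes> (b \<otimes> h)" using mult(2) a b by (simp add: m_assoc)
      then show ?thesis unfolding bh nat_pow_Suc2[OF x] using x b by (simp add: m_assoc)
    qed
    ultimately show ?case using mult(1) by blast
  qed
  then obtain i e where "g = ?x [^] (i::nat) \<otimes> b [^] (e::nat)" by blast
  then have "g = ?x [^] (i mod M) \<otimes> b [^] (e mod 2)"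
    using nat_pow_mod_exponent[OF x M(1)] nat_pow_mod_exponent[OF b b2] by simp
  then show thesis using that[of "i mod M" "e mod 2"] M by simp
qed

section \<open>Normality and commutativity checked on generators\<close>

lemma normal_generate_involutions:
  assumes S: "S \<subseteq> carrier G" "generate G S = carrier G" "\<And>s. s \<in> S \<Longrightarrow> inv s = s"
    and K: "K \<subseteq> carrier G" and conj: "\<And>s k. s \<in> S \<Longrightarrow> k \<in> K \<Longrightarrow> s \<otimes> k \<otimes> s \<in> generate G K"
  shows "generate G K \<lhd> G"
proof (rule normal_invI)
  show sub: "subgroup (generate G K) G" by (rule generate_is_subgroup[OF K])
  \<comment> \<open>For an involution \<open>s\<close> this is conjugation by \<open>s\<close>,
    hence an automorphism: it maps the subgroup into itself as soon as it does so for
    \<open>K\<close>.\<close>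
  have step: "s \<otimes> k \<otimes> s \<in> generate G K" if s: "s \<in> S" and "k \<in> generate G K" for s k
    using that(2)
  proof induction
    case one
    show ?case using s S r_inv[of s] generate.one[of G K] by auto
  next
    case (inv k)
    have "s \<otimes> inv k \<otimes> s = inv (s \<otimes> k \<otimes> s)"
      using s S inv K by (auto simp: inv_mult_group m_assoc subset_iff)
    then show ?case using generate_m_inv_closed[OF K conj[OF s inv]] by simp
  next
    case (eng k l)
    have "s \<in> carrier G" "k \<in> carrier G" "l \<in> carrier G" "inv s = s"
      using s S eng generate_in_carrier[OF K] by auto
    then have "s \<otimes> (k \<otimes> l) \<otimes> s = (s \<otimes> k \<otimes> s) \<otimes> (s \<otimes> l \<otimes> s)"
      by (metis m_assoc m_closed r_inv r_one l_inv l_one)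
    then show ?case using eng by (simp add: generate.eng)
  qed (use conj s in auto)
  fix x h assume x: "x \<in> carrier G" and h: "h \<in> generate G K"
  then have "x \<in> generate G S" using S by simp
  from this S(1) have "\<forall>h\<in>generate G K. x \<otimes> h \<otimes> inv x \<in> generate G K"
  proof (induction rule: generate_left_induct)
    case (inv s)
    then show ?case using S nat_pow_eone by (metis subset_iff)
  next
    case one
    then show ?case using generate_in_carrier[OF K] by auto
  next
    case (mult s g)
    show ?case
    proof
      fix h assume h: "h \<in> generate G K"
      have "s \<otimes> (g \<otimes> h \<otimes> inv g) \<otimes> s \<in> generate G K" using step mult h by blast
      moreover have "s \<otimes> (g \<otimes> h \<otimes> inv g) \<otimes> s = s \<otimes> g \<otimes> h \<otimes> inv (s \<otimes> g)"
        using mult(1,2) S generate_in_carrier[OF K h] by (auto simp: inv_mult_group m_assoc subset_iff)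
      ultimately show "s \<otimes> g \<otimes> h \<otimes> inv (s \<otimes> g) \<in> generate G K" by simp
    qed
  qed
  then show "x \<otimes> h \<otimes> inv x \<in> generate G K" using h by blast
qed

lemma generate_pairwise_commuting:
  assumes S: "S \<subseteq> carrier G" and comm: "\<And>x y. x \<in> S \<Longrightarrow> y \<in> S \<Longrightarrow> x \<otimes> y = y \<otimes> x"
    and "g \<in> generate G S" "h \<in> generate G S"
  shows "g \<otimes> h = h \<otimes> g"
proof -
  have inv_comm: "inv x \<otimes> y = y \<otimes> inv x"
    if "x \<in> carrier G" "y \<in> carrier G" "x \<otimes> y = y \<otimes> x" for x y
    using that by (metis inv_closed inv_solve_left inv_solve_right m_assoc m_closed)
  have mult: "x \<otimes> y \<otimes> z = z \<otimes> (x \<otimes> y)"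
    if "x \<in> carrier G" "y \<in> carrier G" "z \<in> carrier G" "x \<otimes> z = z \<otimes> x" "y \<otimes> z = z \<otimes> y" for x y z
    using that by (metis m_assoc)
  have *: "g \<otimes> s = s \<otimes> g" if "s \<in> S" "g \<in> generate G S" for s g
    using that(2) that(1) S
  proof induction
    case (inv r)
    then show ?case using comm by (intro inv_comm) auto
  next
    case (eng g1 g2)
    then show ?case using generate_in_carrier[OF S] by (intro mult) auto
  qed (use S comm in auto)
  show ?thesis using assms(4)
  proof induction
    case (inv s)
    have "s \<in> carrier G" "g \<in> carrier G" using inv S generate_in_carrier[OF S assms(3)] by auto
    with *[OF inv assms(3)] inv_comm[of s g] show ?case by simp
  next
    case (eng h1 h2)
    then show ?case using generate_in_carrier[OF S] assms(3) by (intro mult[symmetric]) auto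
  qed (use *[OF _ assms(3)] generate_in_carrier[OF S assms(3)] in auto)
qed

section \<open>Solvability of extensions with abelian kernel and of dihedral groups\<close>

lemma solvable_if_commutative:
  assumes "\<And>x y. x \<in> carrier G \<Longrightarrow> y \<in> carrier G \<Longrightarrow> x \<otimes> y = y \<otimes> x"
  shows "solvable G"
proof -
  interpret comm_group G by (rule group_comm_groupI) (rule assms)
  show ?thesis
    unfolding solvable_iff_trivial_derived_seq
    by (rule exI[of _ 1]) (simp add: derived_eq_singleton)
qed

text \<open>Hides the cosets behind a surjection with known kernel; the fixed type of
  \<open>Q\<close> lets later statements quantify over such quotients.\<close>

lemma quotient_map:
  assumes N: "N \<lhd> G"
  obtains Q :: "'a set monoid" and h where "group_hom G Q h" "h ` carrier G = carrier Q"
    "kernel G Q h = N"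
proof
  interpret N: normal N G by (rule N)
  show "group_hom G (G Mod N) ((#>) N)"
    by (intro group_hom.intro is_group N.factorgroup_is_group group_hom_axioms.intro N.r_coset_hom_Mod)
  show "(#>) N ` carrier G = carrier (G Mod N)"
    by (auto simp: FactGroup_def RCOSETS_def)
  show "kernel G (G Mod N) ((#>) N) = N"
    using rcos_self[OF _ N.is_subgroup] N.subset by (auto simp: kernel_def FactGroup_def N.rcos_const)
qed

end

context group_hom
begin

lemma kernelD: "x \<in> kernel G H h \<Longrightarrow> h x = \<one>\<^bsub>H\<^esub>"
  by (simp add: kernel_def)

lemma eq_imp_mult_kernel:
  assumes "x \<in> carrier G" "y \<in> carrier G" "h x = h y"
  obtains n where "n \<in> kernel G H h" "x = n \<otimes> y"
  using that[of "x \<otimes> inv y"] assms by (auto simp: kernel_def G.m_assoc)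

lemma solvable_abelian_kernel:
  assumes surj: "h ` carrier G = carrier H"
    and comm: "\<And>x y. x \<in> kernel G H h \<Longrightarrow> y \<in> kernel G H h \<Longrightarrow> x \<otimes> y = y \<otimes> x"
    and solv: "solvable H"
  shows "solvable G"
proof (rule solvable_condition[OF _ group_hom_axioms surj _ _ solv])
  let ?K = "G\<lparr>carrier := kernel G H h\<rparr>"
  have grp: "group ?K" by (rule G.subgroup_imp_group[OF subgroup_kernel])
  show "group_hom ?K G id"
    by (intro group_hom.intro grp G.is_group group_hom_axioms.intro) (auto simp: hom_def kernel_def)
  show "kernel G H h \<subseteq> id ` carrier ?K" by simp
  show "solvable ?K"
    by (rule group.solvable_if_commutative[OF grp]) (simp add: comm)
qed

end

text \<open>The rotations generated by \<open>a \<otimes> b\<close> form an abelian normal subgroup,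
  and modulo it \<open>a\<close> and \<open>b\<close> coincide, so the quotient is cyclic.\<close>

lemma (in group) solvable_involution_pair:
  assumes a: "a \<in> carrier G" and b: "b \<in> carrier G" and aa: "a \<otimes> a = \<one>" and bb: "b \<otimes> b = \<one>"
    and gen: "generate G {a, b} = carrier G"
  shows "solvable G"
proof -
  have ia: "inv a = a" and ib: "inv b = b" using a b aa bb by (auto intro: inv_equality)
  let ?N = "generate G {a \<otimes> b}"
  have N: "?N \<lhd> G"
  proof (rule normal_generate_involutions[of "{a, b}"])
    fix s k assume "s \<in> {a, b}" "k \<in> {a \<otimes> b}"
    then have "s \<otimes> k \<otimes> s = inv (a \<otimes> b)"
      using a b aa bb by (auto simp: inv_mult_group ia ib m_assoc) (simp add: m_assoc[symmetric])
    then show "s \<otimes> k \<otimes> s \<in> ?N" using generate.inv[of "a \<otimes> b" "{a \<otimes> b}" G] by simp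
  qed (use a b gen ia ib in auto)
  obtain Q :: "'a set monoid" and h where h: "group_hom G Q h" "h ` carrier G = carrier Q"
    "kernel G Q h = ?N"
    by (rule quotient_map[OF N])
  interpret h: group_hom G Q h by (rule h(1))
  show ?thesis
  proof (rule h.solvable_abelian_kernel[OF h(2)])
    show "x \<otimes> y = y \<otimes> x" if "x \<in> kernel G Q h" "y \<in> kernel G Q h" for x y
      by (rule generate_pairwise_commuting[OF _ _ that[unfolded h(3)]]) (use a b in auto)
    have "h (a \<otimes> b) = \<one>\<^bsub>Q\<^esub>"
      by (rule h.kernelD) (simp add: h(3) generate.incl)
    then have "inv\<^bsub>Q\<^esub> (h b) = h a"
      using a b by (intro h.H.inv_equality) auto
    then have ab: "h b = h a" using b ib by (metis h.hom_inv)
    have gen': "generate Q {h a, h b} = carrier Q"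
      using h.generate_img[of "{a, b}"] a b h(2) gen by simp
    show "solvable Q"
    proof (rule h.H.solvable_if_commutative)
      fix x y assume "x \<in> carrier Q" "y \<in> carrier Q"
      then have "x \<in> generate Q {h a}" "y \<in> generate Q {h a}" using gen' ab by auto
      then show "x \<otimes>\<^bsub>Q\<^esub> y = y \<otimes>\<^bsub>Q\<^esub> x"
        by (rule h.H.generate_pairwise_commuting[rotated 2]) (use a in auto)
    qed
  qed
qed

section \<open>The square tessellation\<close>

text \<open>Generation by \<open>a\<close>, \<open>b\<close>, \<open>c\<close> is left to
  \<open>string_group\<close>, so that the relations can also be used for three involutions inside a
  full permutation group.\<close>

locale string_involutions = group G for G (structure) +
  fixes a b c
  assumes a_closed [simp]: "a \<in> carrier G" and b_closed [simp]: "b \<in> carrier G"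
    and c_closed [simp]: "c \<in> carrier G"
    and a_sq [simp]: "a \<otimes> a = \<one>" and b_sq [simp]: "b \<otimes> b = \<one>" and c_sq [simp]: "c \<otimes> c = \<one>"
    and ca: "c \<otimes> a = a \<otimes> c"
begin

lemma inv_gens [simp]: "inv a = a" "inv b = b" "inv c = c"
  by (auto intro: inv_equality)

lemma cancel_gens [simp]:
  assumes "z \<in> carrier G"
  shows "a \<otimes> (a \<otimes> z) = z" "b \<otimes> (b \<otimes> z) = z" "c \<otimes> (c \<otimes> z) = z"
  using assms by (simp_all add: m_assoc[symmetric])

lemma ca_left: "z \<in> carrier G \<Longrightarrow> c \<otimes> (a \<otimes> z) = a \<otimes> (c \<otimes> z)"
  using ca by (simp add: m_assoc[symmetric])

text \<open>Each is a product of two reflections: \<open>a\<close> with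
  \<open>b \<otimes> c \<otimes> b\<close>, and \<open>b \<otimes> a \<otimes> b\<close> with
  \<open>c\<close>. In the square tessellation the two mirrors are parallel, so both products are
  translations.\<close>

abbreviation (input) t1 where "t1 \<equiv> a \<otimes> b \<otimes> c \<otimes> b"
abbreviation (input) t2 where "t2 \<equiv> b \<otimes> a \<otimes> b \<otimes> c"

end

locale string_group = string_involutions +
  assumes generated: "generate G {a, b, c} = carrier G"
begin

lemma gens_left_induct [consumes 1, case_names one mult]:
  assumes "g \<in> carrier G" and "P \<one>"
    and "\<And>s h. s \<in> {a, b, c} \<Longrightarrow> h \<in> carrier G \<Longrightarrow> P h \<Longrightarrow> P (s \<otimes> h)"
  shows "P g"
proof -
  have "g \<in> generate G {a, b, c}" "{a, b, c} \<subseteq> carrier G" using assms(1) generated by auto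
  then show ?thesis
  proof (induction rule: generate_left_induct)
    case (inv s)
    then show ?case using inv_gens a_closed b_closed c_closed nat_pow_eone
      by (metis insertE singletonD)
  qed (use assms in auto)
qed

lemma normal_generate_conj:
  assumes "K \<subseteq> carrier G"
    and "\<And>k. k \<in> K \<Longrightarrow> a \<otimes> k \<otimes> a \<in> generate G K \<and> b \<otimes> k \<otimes> b \<in> generate G K \<and> c \<otimes> k \<otimes> c \<in> generate G K"
  shows "generate G K \<lhd> G"
  by (rule normal_generate_involutions[of "{a, b, c}"]) (use assms generated in auto)

lemma string_group_image:
  assumes "group_hom G Q h" and "h ` carrier G = carrier Q"
  shows "string_group Q (h a) (h b) (h c)"
proof -
  interpret h: group_hom G Q h by fact
  have sq: "h x \<otimes>\<^bsub>Q\<^esub> h x = \<one>\<^bsub>Q\<^esub>" if "x \<in> carrier G" "x \<otimes> x = \<one>" for x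
    using h.hom_mult[OF that(1,1)] that(2) by simp
  show ?thesis
  proof
    show "h c \<otimes>\<^bsub>Q\<^esub> h a = h a \<otimes>\<^bsub>Q\<^esub> h c"
      using ca by (simp add: h.hom_mult[symmetric] del: h.hom_mult)
    show "generate Q {h a, h b, h c} = carrier Q"
      using h.generate_img[of "{a, b, c}"] generated assms(2) by simp
  qed (auto intro: sq)
qed

end

section \<open>The relations of the Coxeter group [4,4] and its translations\<close>

locale square_tessellation = string_involutions +
  assumes ab4: "(a \<otimes> b) [^] (4::nat) = \<one>" and bc4: "(b \<otimes> c) [^] (4::nat) = \<one>"
begin

text \<open>The square of \<open>a \<otimes> b\<close> squares to \<open>\<one>\<close>, so it
  equals its inverse, which is the reversed word.\<close>

lemma baba: "b \<otimes> (a \<otimes> (b \<otimes> a)) = a \<otimes> (b \<otimes> (a \<otimes> b))"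
proof -
  have "inv (a \<otimes> (b \<otimes> (a \<otimes> b))) = a \<otimes> (b \<otimes> (a \<otimes> b))"
    by (rule inv_equality) (use ab4 in \<open>simp_all add: eval_nat_numeral m_assoc\<close>)
  then show ?thesis by (simp add: inv_mult_group m_assoc)
qed

lemma cbcb: "c \<otimes> (b \<otimes> (c \<otimes> b)) = b \<otimes> (c \<otimes> (b \<otimes> c))"
proof -
  have "inv (b \<otimes> (c \<otimes> (b \<otimes> c))) = b \<otimes> (c \<otimes> (b \<otimes> c))"
    by (rule inv_equality) (use bc4 in \<open>simp_all add: eval_nat_numeral m_assoc\<close>)
  then show ?thesis by (simp add: inv_mult_group m_assoc)
qed

lemma braid_left:
  assumes "z \<in> carrier G"
  shows "b \<otimes> (a \<otimes> (b \<otimes> (a \<otimes> z))) = a \<otimes> (b \<otimes> (a \<otimes> (b \<otimes> z)))"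
    "c \<otimes> (b \<otimes> (c \<otimes> (b \<otimes> z))) = b \<otimes> (c \<otimes> (b \<otimes> (c \<otimes> z)))"
  using arg_cong[OF baba, of "\<lambda>w. w \<otimes> z"] arg_cong[OF cbcb, of "\<lambda>w. w \<otimes> z"] assms
  by (simp_all add: m_assoc)

text \<open>The relations oriented towards the alphabetically smaller word; the versions with a tail
  \<open>z\<close> apply inside right-nested products. With the cancellation of squares they verify
  the identities below by rewriting.\<close>

lemmas word_simps = m_assoc inv_mult_group ca ca_left baba cbcb braid_left

lemma translations_commute: "t2 \<otimes> t1 = t1 \<otimes> t2"
  by (simp add: word_simps)

lemma translations_conj:
  "a \<otimes> t1 \<otimes> a = inv t1" "a \<otimes> t2 \<otimes> a = t2"
  "b \<otimes> t1 \<otimes> b = t2" "b \<otimes> t2 \<otimes> b = t1"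
  "c \<otimes> t1 \<otimes> c = t1" "c \<otimes> t2 \<otimes> c = inv t2"
  by (simp_all add: word_simps)

text \<open>Expresses the extra relator of the even case through translations.\<close>

lemma commutator_half_turns:
  "commutator G ((a \<otimes> b) [^] (2::nat)) ((b \<otimes> c) [^] (2::nat)) = (t1 \<otimes> t2) [^] (2::nat)"
  by (simp add: commutator_def eval_nat_numeral word_simps)

end

locale square_tessellation_group = square_tessellation + string_group
begin

lemma translations_normal: "generate G {t1, t2} \<lhd> G"
  by (rule normal_generate_conj)
    (auto simp: translations_conj intro: generate.incl generate.inv)

lemma translations_normal_form:
  assumes "g \<in> carrier G"
  obtains l d where "l \<in> generate G {t1, t2}" "d \<in> generate G {a, b}" "g = l \<otimes> d"
proof -
  let ?L = "generate G {t1, t2}"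
  have sub: "{t1, t2} \<subseteq> carrier G" "{a, b} \<subseteq> carrier G" by auto
  have "\<exists>l d. l \<in> ?L \<and> d \<in> generate G {a, b} \<and> g = l \<otimes> d"
    using assms
  proof (induction rule: gens_left_induct)
    case one
    show ?case using generate.one[of G] r_one[OF one_closed] by metis
  next
    case (mult s h)
    then obtain l d where h: "l \<in> ?L" "d \<in> generate G {a, b}" "h = l \<otimes> d" by blast
    have cl: "l \<in> carrier G" "d \<in> carrier G" "s \<in> carrier G"
      using h mult generate_in_carrier[OF sub(1)] generate_in_carrier[OF sub(2)] by auto
    have si: "inv s = s" using mult by auto
    have conj: "s \<otimes> l \<otimes> s \<in> ?L"
      using normal_invE(2)[OF translations_normal _ h(1), of s] cl si by simp
    have eq: "s \<otimes> h = (s \<otimes> l \<otimes> s) \<otimes> (s \<otimes> d)"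
      using cl si r_inv[of s] by (simp add: h(3) m_assoc) (simp add: m_assoc[symmetric])
    show ?case
    proof (cases "s = c")
      case False
      then have "s \<otimes> d \<in> generate G {a, b}"
        using mult(1) h(2) by (intro generate.eng) (auto intro: generate.incl)
      with eq conj show ?thesis by blast
    next
      case True
      \<comment> \<open>As \<open>t2\<close> is \<open>?e \<otimes> c\<close> with \<open>?e\<close>
        an involution, \<open>c\<close> equals \<open>inv t2 \<otimes> ?e\<close>: the lattice
        factor absorbs \<open>inv t2\<close>, and \<open>?e\<close> goes to the other
        factor.\<close>
      let ?e = "b \<otimes> a \<otimes> b"
      have "?e \<in> generate G {a, b}" by (intro generate.eng) (auto intro: generate.incl)
      then have "?e \<otimes> d \<in> generate G {a, b}" using h(2) by (rule generate.eng)
      moreover have "s \<otimes> l \<otimes> s \<otimes> inv t2 \<in> ?L"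
        by (intro generate.eng[OF conj] generate.inv) simp
      moreover have "s \<otimes> h = (s \<otimes> l \<otimes> s \<otimes> inv t2) \<otimes> (?e \<otimes> d)"
        unfolding eq using cl True by (simp add: m_assoc inv_mult_group)
      ultimately show ?thesis by blast
    qed
  qed
  then show thesis using that by blast
qed

text \<open>Modulo the abelian group of translations \<open>c\<close> equals
  \<open>b \<otimes> a \<otimes> b\<close>, so the quotient is generated by two involutions.\<close>

lemma tessellation_solvable: "solvable G"
proof -
  let ?L = "generate G {t1, t2}"
  obtain Q :: "'a set monoid" and h where h: "group_hom G Q h" "h ` carrier G = carrier Q"
    "kernel G Q h = ?L"
    by (rule quotient_map[OF translations_normal])
  interpret h: group_hom G Q h by (rule h(1))
  interpret q: string_group Q "h a" "h b" "h c"
    by (rule string_group_image[OF h(1,2)])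
  show ?thesis
  proof (rule h.solvable_abelian_kernel[OF h(2)])
    show "x \<otimes> y = y \<otimes> x" if "x \<in> kernel G Q h" "y \<in> kernel G Q h" for x y
      by (rule generate_pairwise_commuting[OF _ _ that[unfolded h(3)]])
        (use translations_commute in auto)
    have "h c = h (b \<otimes> a \<otimes> b \<otimes> t2)" by (simp add: m_assoc)
    also have "\<dots> = h (b \<otimes> a \<otimes> b) \<otimes>\<^bsub>Q\<^esub> h t2" by (rule h.hom_mult) auto
    also have "h t2 = \<one>\<^bsub>Q\<^esub>" by (rule h.kernelD) (simp add: h(3) generate.incl)
    finally have c: "h c = h b \<otimes>\<^bsub>Q\<^esub> h a \<otimes>\<^bsub>Q\<^esub> h b" by simp
    let ?D = "generate Q {h a, h b}"
    have "h c \<in> ?D" unfolding c by (intro generate.eng) (auto intro: generate.incl)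
    then have "generate Q {h a, h b, h c} \<subseteq> ?D"
      by (intro h.H.generate_subgroup_incl h.H.generate_is_subgroup) (auto intro: generate.incl)
    then have "carrier Q \<subseteq> ?D" using q.generated by simp
    moreover have "?D \<subseteq> carrier Q" by (rule h.H.generate_incl) auto
    ultimately have "?D = carrier Q" by (rule subset_antisym[rotated])
    then show "solvable Q"
      by (rule h.H.solvable_involution_pair[OF q.a_closed q.b_closed q.a_sq q.b_sq])
  qed
qed

end

section \<open>Homomorphisms out of the presented group\<close>

lemma (in group) commutator_eq_one_iff:
  assumes "x \<in> carrier G" "y \<in> carrier G"
  shows "commutator G x y = \<one> \<longleftrightarrow> x \<otimes> y = y \<otimes> x"
proof -
  have "commutator G x y = inv (y \<otimes> x) \<otimes> (x \<otimes> y)"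
    using assms by (simp add: commutator_def inv_mult_group m_assoc)
  also have "\<dots> = \<one> \<longleftrightarrow> x \<otimes> y = y \<otimes> x"
    using assms inv_solve_left[of \<one> "y \<otimes> x" "x \<otimes> y"] by auto
  finally show ?thesis .
qed

lemma (in group_hom) hom_commutator:
  assumes "x \<in> carrier G" "y \<in> carrier G"
  shows "h (commutator G x y) = commutator H (h x) (h y)"
  using assms by (simp add: commutator_def)

text \<open>The relators are words in the generators, so a homomorphism sends them to the same words
  in the images. This transports them from the free group to the presented group and to the
  models.\<close>

lemma (in group_hom) hom_common_relators:
  assumes "\<And>i. i \<in> {0, 1, 2} \<Longrightarrow> \<rho> i \<in> carrier G"
  shows "h ` common_relators G \<rho> s t l1 l2 = common_relators H (h \<circ> \<rho>) s t l1 l2"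
  using assms by (simp add: common_relators_def hom_nat_pow hom_commutator)

lemma (in group_hom) hom_extra_relator:
  assumes "\<And>i. i \<in> {0, 1, 2} \<Longrightarrow> \<rho> i \<in> carrier G"
  shows "h (extra_relator G \<rho> s t n) = extra_relator H (h \<circ> \<rho>) s t n"
  using assms by (simp add: extra_relator_def hom_nat_pow hom_commutator commutator_def del: even_diff_nat)

lemma (in group) common_relators_closed:
  assumes "\<And>i. i \<in> {0, 1, 2} \<Longrightarrow> \<rho> i \<in> carrier G"
  shows "common_relators G \<rho> s t l1 l2 \<subseteq> carrier G" "extra_relator G \<rho> s t n \<in> carrier G"
  using assms by (auto simp: common_relators_def extra_relator_def commutator_def)

lemma (in group) trivial_common_relators:
  assumes "\<And>i. i \<in> {0, 1, 2} \<Longrightarrow> \<rho> i \<in> carrier G" and "common_relators G \<rho> s t l1 l2 \<subseteq> {\<one>}"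
  shows "string_involutions G (\<rho> 0) (\<rho> 1) (\<rho> 2)"
    and "(\<rho> 0 \<otimes> \<rho> 1) [^] (2 ^ s * l1) = \<one>"
    and "(\<rho> 1 \<otimes> \<rho> 2) [^] (2 ^ t * l2) = \<one>"
    and "\<rho> 2 \<otimes> (\<rho> 0 \<otimes> \<rho> 1) [^] (4::nat) = (\<rho> 0 \<otimes> \<rho> 1) [^] (4::nat) \<otimes> \<rho> 2"
    and "\<rho> 0 \<otimes> (\<rho> 1 \<otimes> \<rho> 2) [^] (4::nat) = (\<rho> 1 \<otimes> \<rho> 2) [^] (4::nat) \<otimes> \<rho> 0"
proof -
  have closed: "\<rho> 0 \<in> carrier G" "\<rho> 1 \<in> carrier G" "\<rho> 2 \<in> carrier G" using assms(1) by auto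
  note rel = assms(2)[unfolded common_relators_def insert_subset singleton_iff]
  have sq: "\<rho> 0 \<otimes> \<rho> 0 = \<one>" "\<rho> 1 \<otimes> \<rho> 1 = \<one>" "\<rho> 2 \<otimes> \<rho> 2 = \<one>"
    using rel closed by (simp_all add: numeral_2_eq_2)
  \<comment> \<open>The product squares to \<open>\<one>\<close>, so it equals its inverse
    \<open>\<rho> 2 \<otimes> \<rho> 0\<close>.\<close>
  have "inv (\<rho> 0 \<otimes> \<rho> 2) = \<rho> 0 \<otimes> \<rho> 2"
    by (rule inv_equality) (use rel closed in \<open>simp_all add: numeral_2_eq_2\<close>)
  moreover have "inv (\<rho> 0) = \<rho> 0" "inv (\<rho> 2) = \<rho> 2"
    using closed sq by (auto intro: inv_equality)
  ultimately have "\<rho> 2 \<otimes> \<rho> 0 = \<rho> 0 \<otimes> \<rho> 2" using closed by (simp add: inv_mult_group)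
  with closed sq show "string_involutions G (\<rho> 0) (\<rho> 1) (\<rho> 2)"
    by unfold_locales
qed (use assms in \<open>auto simp: common_relators_def commutator_eq_one_iff\<close>)

text \<open>Turns three elements into an indexed family, the form in which the relators take their
  generators.\<close>

definition gen_triple :: "'a \<Rightarrow> 'a \<Rightarrow> 'a \<Rightarrow> nat \<Rightarrow> 'a" where
  "gen_triple a b c i = (if i = 0 then a else if i = 1 then b else c)"

lemma gen_triple_simps [simp]:
  "gen_triple a b c 0 = a" "gen_triple a b c (Suc 0) = b" "gen_triple a b c 2 = c"
  by (simp_all add: gen_triple_def)

definition (in group) satisfies_relators where
  "satisfies_relators s t n l1 l2 a b c \<longleftrightarrow>
     a \<in> carrier G \<and> b \<in> carrier G \<and> c \<in> carrier G \<and>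
     common_relators G (gen_triple a b c) s t l1 l2 \<subseteq> {\<one>} \<and>
     extra_relator G (gen_triple a b c) s t n = \<one>"

context string_involutions
begin

text \<open>Expresses the extra relator of the odd case through \<open>t2\<close>: in the expanded
  word \<open>c\<close> moves past \<open>a\<close>, and the two letters \<open>a\<close> around it
  cancel.\<close>

lemma commutator_half_turn: "commutator G ((a \<otimes> b) [^] (2::nat)) c = t2 [^] (2::nat)"
  by (simp add: commutator_def eval_nat_numeral m_assoc inv_mult_group ca_left)

lemma satisfies_relatorsI:
  assumes "(a \<otimes> b) [^] (2 ^ s * l1) = \<one>" "(b \<otimes> c) [^] (2 ^ t * l2) = \<one>"
    and "c \<otimes> (a \<otimes> b) [^] (4::nat) = (a \<otimes> b) [^] (4::nat) \<otimes> c"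
    and "a \<otimes> (b \<otimes> c) [^] (4::nat) = (b \<otimes> c) [^] (4::nat) \<otimes> a"
    and "odd (n - s - t) \<Longrightarrow> (t2 [^] (2::nat)) [^] ((2::nat) ^ ((n - s - t - 1) div 2)) = \<one>"
    and "even (n - s - t) \<Longrightarrow> commutator G ((a \<otimes> b) [^] (2::nat)) ((b \<otimes> c) [^] (2::nat))
      [^] ((2::nat) ^ ((n - s - t - 2) div 2)) = \<one>"
  shows "satisfies_relators s t n l1 l2 a b c"
proof -
  have "a [^] (2::nat) = \<one>" "b [^] (2::nat) = \<one>" "c [^] (2::nat) = \<one>" "(a \<otimes> c) [^] (2::nat) = \<one>"
    by (simp_all add: numeral_2_eq_2 m_assoc ca_left)
  with assms show ?thesis
    by (simp add: satisfies_relators_def common_relators_def extra_relator_def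
        commutator_eq_one_iff commutator_half_turn)
qed

end

text \<open>The exponents \<open>2 ^ s * l1\<close> and \<open>2 ^ t * l2\<close> are multiples of
  4. The \<open>Suc\<close> appears because the commutators in the extra relator are the squares of
  \<open>t2\<close> and of \<open>t1 \<otimes> t2\<close>.\<close>

lemma (in square_tessellation) satisfies_relatorsI_tessellation:
  assumes "s \<ge> 2" "t \<ge> 2"
    and "odd (n - s - t) \<Longrightarrow> t2 [^] ((2::nat) ^ Suc ((n - s - t - 1) div 2)) = \<one>"
    and "even (n - s - t) \<Longrightarrow> (t1 \<otimes> t2) [^] ((2::nat) ^ Suc ((n - s - t - 2) div 2)) = \<one>"
  shows "satisfies_relators s t n l1 l2 a b c"
proof (rule satisfies_relatorsI)
  have "4 dvd (2::nat) ^ s" "4 dvd (2::nat) ^ t"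
    using le_imp_power_dvd[OF assms(1), of "2::nat"] le_imp_power_dvd[OF assms(2), of "2::nat"] by simp_all
  then have dvd: "4 dvd 2 ^ s * l1" "4 dvd 2 ^ t * l2" by (simp_all add: dvd_mult2)
  have pow: "x [^] d = \<one>" if "x \<in> carrier G" "x [^] (4::nat) = \<one>" "4 dvd d" for x and d :: nat
  proof -
    obtain k where "d = 4 * k" using \<open>4 dvd d\<close> by blast
    then have "x [^] d = (x [^] (4::nat)) [^] k" by (simp only: nat_pow_pow[OF that(1)])
    then show ?thesis using that by simp
  qed
  show "(a \<otimes> b) [^] (2 ^ s * l1) = \<one>" "(b \<otimes> c) [^] (2 ^ t * l2) = \<one>"
    using dvd ab4 bc4 by (auto intro!: pow)
qed (use assms(3,4) in \<open>simp_all add: ab4 bc4 commutator_half_turns nat_pow_pow\<close>)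

lemma presented_relators_hom:
  fixes s t n l1 l2 :: nat
  defines "R \<equiv> relators s t n l1 l2"
  assumes "group H" and "group.satisfies_relators H s t n l1 l2 a b c"
  obtains g where "group_hom (presented_group {0, 1, 2} R) H g"
    "g (presented_gen {0, 1, 2} R 0) = a" "g (presented_gen {0, 1, 2} R 1) = b"
    "g (presented_gen {0, 1, 2} R 2) = c"
proof -
  let ?S = "{0, 1, 2 :: nat}"
  let ?F = "free_group ?S" and ?f = "gen_triple a b c"
  interpret F: group ?F by (rule group_free_group)
  interpret H: group H by fact
  note sat = assms(3)[unfolded H.satisfies_relators_def]
  have R: "R \<subseteq> carrier ?F"
    using F.common_relators_closed[of "free_gen ?S"] by (auto simp: R_def relators_def Let_def)
  obtain g where g: "g \<in> hom (presented_group ?S R) H"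
    "\<And>x. x \<in> ?S \<Longrightarrow> g (presented_gen ?S R x) = ?f x"
  proof (rule presented_group_hom[OF R H.group_axioms])
    show "?f \<in> ?S \<rightarrow> carrier H" using sat by auto
    fix h assume h: "h \<in> hom ?F H" "\<And>x. x \<in> ?S \<Longrightarrow> h (free_gen ?S x) = ?f x"
    interpret h: group_hom ?F H h
      by (intro group_hom.intro F.group_axioms H.group_axioms group_hom_axioms.intro h)
    \<comment> \<open>The two families agree at 0, 1 and 2, and the relators look at these indices
      alone.\<close>
    have "common_relators H (h \<circ> free_gen ?S) s t l1 l2 = common_relators H ?f s t l1 l2"
      "extra_relator H (h \<circ> free_gen ?S) s t n = extra_relator H ?f s t n"
      using h(2) by (simp_all add: common_relators_def extra_relator_def del: even_diff_nat)
    moreover have "h ` common_relators ?F (free_gen ?S) s t l1 l2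
        = common_relators H (h \<circ> free_gen ?S) s t l1 l2"
      "h (extra_relator ?F (free_gen ?S) s t n) = extra_relator H (h \<circ> free_gen ?S) s t n"
      by (rule h.hom_common_relators h.hom_extra_relator, simp)+
    ultimately show "h ` R \<subseteq> {\<one>\<^bsub>H\<^esub>}"
      using sat by (auto simp: R_def relators_def Let_def image_Un)
  qed blast
  moreover have "group_hom (presented_group ?S R) H g"
    by (intro group_hom.intro group_presented_group[OF R] H.group_axioms group_hom_axioms.intro g)
  ultimately show thesis using that[of g] by auto
qed

text \<open>With \<open>\<one>\<close> for \<open>c\<close>, the product
  \<open>b \<otimes> c\<close> is the involution \<open>b\<close>, which dies in every even power,
  and the extra relator is a power of the square of \<open>b \<otimes> a \<otimes> b\<close> or of a
  commutator with the square of \<open>b\<close>.\<close>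

lemma (in group) dihedral_satisfies_relators:
  assumes "a \<in> carrier G" "b \<in> carrier G" "a \<otimes> a = \<one>" "b \<otimes> b = \<one>"
    and "(a \<otimes> b) [^] (2 ^ s * l1) = \<one>" and "t \<ge> 2"
  shows "satisfies_relators s t n l1 l2 a b \<one>"
proof -
  interpret string_involutions G a b \<one> by unfold_locales (use assms in auto)
  have b2: "b [^] (2::nat) = \<one>" by (simp add: numeral_2_eq_2)
  have "2 ^ t * l2 = 2 * (2 ^ (t - 1) * l2)" using assms(6) by (cases t) auto
  then have "b [^] (2 ^ t * l2) = \<one>" by (metis b2 b_closed nat_pow_one nat_pow_pow)
  moreover have "b [^] (4::nat) = \<one>" by (simp add: eval_nat_numeral)
  moreover have "commutator G ((a \<otimes> b) [^] (2::nat)) \<one> = \<one>"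
    by (simp add: commutator_eq_one_iff)
  moreover have "(b \<otimes> a \<otimes> b) [^] (2::nat) = \<one>" by (simp add: numeral_2_eq_2 m_assoc)
  ultimately show ?thesis
    using assms(5) b2 by (intro satisfies_relatorsI) simp_all
qed

text \<open>With \<open>\<one>\<close> for \<open>a\<close>, the product
  \<open>a \<otimes> b\<close> is the involution \<open>b\<close>, and the extra relator is a power
  of the square of \<open>c\<close> or of a commutator with \<open>\<one>\<close>.\<close>

lemma (in group) dual_dihedral_satisfies_relators:
  assumes "b \<in> carrier G" "c \<in> carrier G" "b \<otimes> b = \<one>" "c \<otimes> c = \<one>"
    and "(b \<otimes> c) [^] (2 ^ t * l2) = \<one>" and "s \<ge> 2"
  shows "satisfies_relators s t n l1 l2 \<one> b c"
proof -
  interpret string_involutions G \<one> b c by unfold_locales (use assms in auto)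
  have b2: "b [^] (2::nat) = \<one>" by (simp add: numeral_2_eq_2)
  have "2 ^ s * l1 = 2 * (2 ^ (s - 1) * l1)" using assms(6) by (cases s) auto
  then have "b [^] (2 ^ s * l1) = \<one>" by (metis b2 b_closed nat_pow_one nat_pow_pow)
  moreover have "b [^] (4::nat) = \<one>" by (simp add: eval_nat_numeral)
  moreover have "commutator G \<one> ((b \<otimes> c) [^] (2::nat)) = \<one>"
    by (simp add: commutator_eq_one_iff)
  moreover have "c [^] (2::nat) = \<one>" by (simp add: numeral_2_eq_2)
  ultimately show ?thesis
    using assms(5) b2 by (intro satisfies_relatorsI) simp_all
qed

text \<open>The quotient of the tessellation group by its translations.\<close>

lemma (in group) point_group_satisfies_relators:
  assumes "a \<in> carrier G" "b \<in> carrier G" "a \<otimes> a = \<one>" "b \<otimes> b = \<one>"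
    and ab: "(a \<otimes> b) [^] (4::nat) = \<one>" and "s \<ge> 2" "t \<ge> 2"
  shows "satisfies_relators s t n l1 l2 a b (b \<otimes> a \<otimes> b)"
proof -
  have inv: "inv a = a" "inv b = b" using assms by (auto intro: inv_equality)
  have cancel: "a \<otimes> (a \<otimes> z) = z" "b \<otimes> (b \<otimes> z) = z" if "z \<in> carrier G" for z
    using that assms by (simp_all add: m_assoc[symmetric])
  have "inv (a \<otimes> (b \<otimes> (a \<otimes> b))) = a \<otimes> (b \<otimes> (a \<otimes> b))"
    by (rule inv_equality) (use assms in \<open>simp_all add: eval_nat_numeral m_assoc\<close>)
  then have baba: "b \<otimes> (a \<otimes> (b \<otimes> a)) = a \<otimes> (b \<otimes> (a \<otimes> b))"
    using assms by (simp add: inv_mult_group m_assoc inv)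
  \<comment> \<open>The third generator times \<open>b\<close> gives the same rotation as
    \<open>a\<close> and \<open>b\<close>, so the two relations of order 4 coincide.\<close>
  have bc: "b \<otimes> (b \<otimes> a \<otimes> b) = a \<otimes> b" using assms by (simp add: m_assoc cancel)
  interpret square_tessellation G a b "b \<otimes> a \<otimes> b"
    by unfold_locales (use assms in \<open>simp_all add: bc\<close>, use assms in \<open>simp_all add: m_assoc cancel baba\<close>)
  show ?thesis
    \<comment> \<open>Both translations collapse to \<open>\<one>\<close> here, which settles the
      extra relator.\<close>
    using assms by (intro satisfies_relatorsI_tessellation) (simp_all add: m_assoc)
qed

text \<open>For commuting involutions \<open>t2\<close> reduces to \<open>a \<otimes> c\<close> and
  \<open>t1 \<otimes> t2\<close> to \<open>\<one>\<close>. This makes the parity of each generator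
  well defined on the presented group.\<close>

lemma (in group) commuting_satisfies_relators:
  assumes "a \<in> carrier G" "b \<in> carrier G" "c \<in> carrier G"
    "a \<otimes> a = \<one>" "b \<otimes> b = \<one>" "c \<otimes> c = \<one>"
    and ba: "b \<otimes> a = a \<otimes> b" and ca: "c \<otimes> a = a \<otimes> c" and cb: "c \<otimes> b = b \<otimes> c"
    and "s \<ge> 2" "t \<ge> 2"
  shows "satisfies_relators s t n l1 l2 a b c"
proof -
  interpret string_involutions G a b c by unfold_locales (use assms in auto)
  have left: "b \<otimes> (a \<otimes> z) = a \<otimes> (b \<otimes> z)" "c \<otimes> (b \<otimes> z) = b \<otimes> (c \<otimes> z)" if "z \<in> carrier G" for z
    using that ba cb by (simp_all add: m_assoc[symmetric])
  note word = m_assoc ba ca cb left ca_left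
  interpret square_tessellation G a b c
    by unfold_locales (simp_all add: eval_nat_numeral word)
  have t2: "t2 [^] (2::nat) = \<one>" "(t1 \<otimes> t2) [^] (2::nat) = \<one>"
    by (simp_all add: numeral_2_eq_2 word)
  have "x [^] ((2::nat) ^ Suc m) = \<one>" if "x \<in> carrier G" "x [^] (2::nat) = \<one>" for x m
    using that by (simp add: nat_pow_pow[symmetric])
  then show ?thesis
    using assms t2 by (intro satisfies_relatorsI_tessellation) simp_all
qed

section \<open>Models of the quotients\<close>

lemma primitive_root_of_unity:
  fixes M :: nat
  assumes "M > 0"
  obtains \<omega> :: complex where "\<omega> * cnj \<omega> = 1" "\<And>k. \<omega> ^ k = 1 \<longleftrightarrow> M dvd k"
    "\<And>k l. k < M \<Longrightarrow> l < M \<Longrightarrow> \<omega> ^ k = \<omega> ^ l \<Longrightarrow> k = l"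
proof
  let ?w = "cis (2 * pi / real M)"
  have pow: "?w ^ k = cis (2 * pi * real k / real M)" for k
    by (simp add: DeMoivre mult_ac)
  have inj: "inj_on (\<lambda>k. ?w ^ k) {..<M}"
    using bij_betw_roots_unity[OF assms] by (simp add: bij_betw_def pow)
  show "k = l" if "k < M" "l < M" "?w ^ k = ?w ^ l" for k l
    using inj_onD[OF inj, of k l] that by simp
  have one: "?w ^ M = 1" using assms by (simp add: pow)
  show "?w ^ k = 1 \<longleftrightarrow> M dvd k" for k
  proof -
    have "?w ^ k = ?w ^ (M * (k div M) + k mod M)" by simp
    also have "\<dots> = ?w ^ (k mod M)" by (simp only: power_add power_mult one) simp
    finally have "?w ^ k = 1 \<longleftrightarrow> ?w ^ (k mod M) = ?w ^ 0" by simp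
    also have "\<dots> \<longleftrightarrow> k mod M = 0" using inj_onD[OF inj, of "k mod M" 0] assms by auto
    finally show ?thesis by (simp add: dvd_eq_mod_eq_0)
  qed
  show "?w * cnj ?w = 1" by (simp add: cis_cnj cis_mult)
qed

section \<open>Dihedral groups acting on the complex plane\<close>

abbreviation perm_group :: "('a \<Rightarrow> 'a) monoid" where "perm_group \<equiv> BijGroup UNIV"

lemma perm_group_simps [simp]:
  "f \<in> carrier perm_group \<longleftrightarrow> bij f"
  "bij f \<Longrightarrow> bij g \<Longrightarrow> f \<otimes>\<^bsub>perm_group\<^esub> g = f \<circ> g"
  "\<one>\<^bsub>perm_group\<^esub> = id"
  by (auto simp: BijGroup_def Bij_def compose_def)

interpretation perm: group perm_group by (rule group_BijGroup)

lemma unit_complex_cancel: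
  fixes u :: complex
  assumes "u * cnj u = 1"
  shows "u * (cnj u * z) = z" "cnj u * (u * z) = z"
proof -
  have "cnj u * u = 1" using assms by (simp add: mult.commute)
  with assms show "u * (cnj u * z) = z" "cnj u * (u * z) = z"
    by (simp_all add: mult.assoc[symmetric])
qed

definition rotation :: "complex \<Rightarrow> complex \<Rightarrow> complex" where "rotation u z = u * z"

definition reflection :: "complex \<Rightarrow> complex \<Rightarrow> complex" where "reflection u z = u * cnj z"

lemma bij_rotation: "u * cnj u = 1 \<Longrightarrow> bij (rotation u)"
  by (rule o_bij[of "rotation (cnj u)"]) (auto simp: rotation_def fun_eq_iff unit_complex_cancel)

lemma bij_reflection: "u * cnj u = 1 \<Longrightarrow> bij (reflection u)"
  by (rule o_bij[of "reflection u"]) (auto simp: reflection_def fun_eq_iff unit_complex_cancel)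

lemma rotation_pow:
  assumes "u * cnj u = 1"
  shows "rotation u [^]\<^bsub>perm_group\<^esub> (n::nat) = rotation (u ^ n)"
proof (induction n)
  case (Suc n)
  have "(u ^ n) * cnj (u ^ n) = 1" using assms by (metis complex_cnj_power power_mult_distrib power_one)
  then show ?case using assms Suc
    by (simp add: bij_rotation) (auto simp: rotation_def fun_eq_iff mult_ac)
qed (auto simp: rotation_def fun_eq_iff)

text \<open>Two reflections of the plane compose to the rotation by a primitive root of unity of
  order \<open>M\<close>. The last clause holds because rotations preserve orientation and
  reflections do not.\<close>

lemma dihedral_model:
  fixes M :: nat
  assumes "M > 0"
  obtains \<alpha> \<beta> :: "complex \<Rightarrow> complex" where
    "\<alpha> \<in> carrier perm_group" "\<beta> \<in> carrier perm_group"
    "\<alpha> \<otimes>\<^bsub>perm_group\<^esub> \<alpha> = \<one>\<^bsub>perm_group\<^esub>" "\<beta> \<otimes>\<^bsub>perm_group\<^esub> \<beta> = \<one>\<^bsub>perm_group\<^esub>"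
    "\<And>k::nat. (\<alpha> \<otimes>\<^bsub>perm_group\<^esub> \<beta>) [^]\<^bsub>perm_group\<^esub> k = \<one>\<^bsub>perm_group\<^esub> \<longleftrightarrow> M dvd k"
    "\<And>k::nat. (\<alpha> \<otimes>\<^bsub>perm_group\<^esub> \<beta>) [^]\<^bsub>perm_group\<^esub> k \<noteq> \<beta>"
proof -
  obtain \<omega> where w: "\<omega> * cnj \<omega> = 1" "\<And>k. \<omega> ^ k = 1 \<longleftrightarrow> M dvd k"
    using primitive_root_of_unity[OF assms] by metis
  have w': "cnj \<omega> * cnj (cnj \<omega>) = 1" using w by (simp add: mult.commute)
  have ab: "reflection 1 \<otimes>\<^bsub>perm_group\<^esub> reflection (cnj \<omega>) = rotation \<omega>"
    using bij_reflection[OF w'] bij_reflection[of 1]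
    by (simp add: fun_eq_iff reflection_def rotation_def)
  show thesis
  proof
    show "reflection 1 \<in> carrier perm_group" "reflection (cnj \<omega>) \<in> carrier perm_group"
      using bij_reflection[OF w'] bij_reflection[of 1] by simp_all
    show "reflection 1 \<otimes>\<^bsub>perm_group\<^esub> reflection 1 = \<one>\<^bsub>perm_group\<^esub>"
      using bij_reflection[of 1] by (simp add: fun_eq_iff reflection_def)
    show "reflection (cnj \<omega>) \<otimes>\<^bsub>perm_group\<^esub> reflection (cnj \<omega>) = \<one>\<^bsub>perm_group\<^esub>"
      using bij_reflection[OF w'] by (simp add: fun_eq_iff reflection_def unit_complex_cancel[OF w(1)])
    fix k :: nat
    have "rotation u = id \<longleftrightarrow> u = 1" for u
      by (auto simp: rotation_def fun_eq_iff dest: spec[of _ 1])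
    then show "(reflection 1 \<otimes>\<^bsub>perm_group\<^esub> reflection (cnj \<omega>)) [^]\<^bsub>perm_group\<^esub> k = \<one>\<^bsub>perm_group\<^esub> \<longleftrightarrow> M dvd k"
      using w by (simp add: ab rotation_pow del: perm_group_simps(2))
    have "rotation u \<noteq> reflection v" if "v \<noteq> 0" for u v
    proof
      assume "rotation u = reflection v"
      \<comment> \<open>The values at 1 and \<open>\<i>\<close> give \<open>u = v\<close> and
        \<open>u = - v\<close>.\<close>
      then have "rotation u 1 = reflection v 1" "rotation u \<i> = reflection v \<i>" by simp_all
      then show False using that by (simp add: rotation_def reflection_def)
    qed
    moreover have "cnj \<omega> \<noteq> 0" using w by auto
    ultimately show "(reflection 1 \<otimes>\<^bsub>perm_group\<^esub> reflection (cnj \<omega>)) [^]\<^bsub>perm_group\<^esub> k \<noteq> reflection (cnj \<omega>)"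
      using w by (simp add: ab rotation_pow del: perm_group_simps(2))
  qed
qed

section \<open>Torus groups acting on pairs of complex numbers\<close>

definition biscale :: "complex \<Rightarrow> complex \<Rightarrow> complex \<times> complex \<Rightarrow> complex \<times> complex" where
  "biscale u v = map_prod (rotation u) (rotation v)"

lemma biscale_apply: "biscale u v (z, w) = (u * z, v * w)"
  by (simp add: biscale_def rotation_def)

lemma biscale_eq_iff: "biscale u v = biscale u' v' \<longleftrightarrow> u = u' \<and> v = v'"
proof
  assume "biscale u v = biscale u' v'"
  then have "biscale u v (1, 1) = biscale u' v' (1, 1)" by simp
  then show "u = u' \<and> v = v'" by (simp add: biscale_apply)
qed simp

lemma bij_biscale: "u \<noteq> 0 \<Longrightarrow> v \<noteq> 0 \<Longrightarrow> bij (biscale u v)"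
  by (rule o_bij[of "biscale (inverse u) (inverse v)"]) (auto simp: biscale_apply fun_eq_iff)

lemma biscale_mult:
  assumes "u \<noteq> 0" "v \<noteq> 0" "u' \<noteq> 0" "v' \<noteq> 0"
  shows "biscale u v \<otimes>\<^bsub>perm_group\<^esub> biscale u' v' = biscale (u * u') (v * v')"
  using assms by (simp add: bij_biscale fun_eq_iff biscale_apply)

lemma biscale_pow:
  assumes "u \<noteq> 0" "v \<noteq> 0"
  shows "biscale u v [^]\<^bsub>perm_group\<^esub> (n::nat) = biscale (u ^ n) (v ^ n)"
proof (induction n)
  case 0
  show ?case by (simp add: biscale_apply fun_eq_iff)
next
  case (Suc n)
  then show ?case using assms by (simp add: biscale_mult mult.commute del: perm_group_simps(2))
qed

text \<open>The rectangular torus: \<open>\<langle>a, bcb\<rangle>\<close> and \<open>\<langle>bab, c\<rangle>\<close> act as dihedral groups on the first and on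
  the second coordinate.\<close>

lemma rectangular_torus_model:
  fixes M :: nat
  assumes "M > 0"
  obtains \<alpha> \<beta> \<gamma> :: "complex \<times> complex \<Rightarrow> complex \<times> complex" and \<tau>1 \<tau>2 where
    "square_tessellation perm_group \<alpha> \<beta> \<gamma>"
    "\<tau>1 = \<alpha> \<otimes>\<^bsub>perm_group\<^esub> \<beta> \<otimes>\<^bsub>perm_group\<^esub> \<gamma> \<otimes>\<^bsub>perm_group\<^esub> \<beta>"
    "\<tau>2 = \<beta> \<otimes>\<^bsub>perm_group\<^esub> \<alpha> \<otimes>\<^bsub>perm_group\<^esub> \<beta> \<otimes>\<^bsub>perm_group\<^esub> \<gamma>"
    "\<tau>2 [^]\<^bsub>perm_group\<^esub> M = \<one>\<^bsub>perm_group\<^esub>"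
    "inj_on (\<lambda>(i, j). \<tau>1 [^]\<^bsub>perm_group\<^esub> i \<otimes>\<^bsub>perm_group\<^esub> \<tau>2 [^]\<^bsub>perm_group\<^esub> j) ({..<M} \<times> {..<M})"
proof -
  obtain \<omega> where w: "\<omega> * cnj \<omega> = 1" "\<And>k. \<omega> ^ k = 1 \<longleftrightarrow> M dvd k"
    "\<And>k l. k < M \<Longrightarrow> l < M \<Longrightarrow> \<omega> ^ k = \<omega> ^ l \<Longrightarrow> k = l"
    using primitive_root_of_unity[OF assms] by metis
  have w0: "\<omega> \<noteq> 0" using w(1) by auto
  note w2 = unit_complex_cancel[OF w(1)]
  \<comment> \<open>\<open>\<beta> \<circ> \<alpha> \<circ> \<beta>\<close> conjugates the second
    coordinate, so composing it with \<open>\<gamma>\<close> multiplies that coordinate by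
    \<open>\<omega>\<close>; the swap \<open>\<beta>\<close> moves this to the first
    coordinate.\<close>
  define \<alpha> \<beta> \<gamma> where "\<alpha> = (\<lambda>(z, w). (cnj z, w :: complex))"
    and "\<beta> = (\<lambda>(z :: complex, w :: complex). (w, z))"
    and "\<gamma> = (\<lambda>(z :: complex, w). (z, cnj \<omega> * cnj w))"
  note defs = \<alpha>_def \<beta>_def \<gamma>_def
  have inv: "\<alpha> \<circ> \<alpha> = id" "\<beta> \<circ> \<beta> = id" "\<gamma> \<circ> \<gamma> = id"
    by (auto simp: defs fun_eq_iff w2)
  have bij [simp]: "bij \<alpha>" "bij \<beta>" "bij \<gamma>"
    using inv by (auto intro: o_bij)
  note [simp] = bij_comp bij
  have t1: "\<alpha> \<otimes>\<^bsub>perm_group\<^esub> \<beta> \<otimes>\<^bsub>perm_group\<^esub> \<gamma> \<otimes>\<^bsub>perm_group\<^esub> \<beta> = biscale \<omega> 1"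
    and t2: "\<beta> \<otimes>\<^bsub>perm_group\<^esub> \<alpha> \<otimes>\<^bsub>perm_group\<^esub> \<beta> \<otimes>\<^bsub>perm_group\<^esub> \<gamma> = biscale 1 \<omega>"
    by (simp_all, simp_all add: fun_eq_iff biscale_apply defs)
  show thesis
  proof (rule that[OF _ t1[symmetric] t2[symmetric]])
    show "square_tessellation perm_group \<alpha> \<beta> \<gamma>"
      by unfold_locales
        (simp_all add: eval_nat_numeral inv, simp_all add: fun_eq_iff defs w2)
    show "biscale 1 \<omega> [^]\<^bsub>perm_group\<^esub> M = \<one>\<^bsub>perm_group\<^esub>"
      using w0 w(2) by (simp add: biscale_pow biscale_apply fun_eq_iff)
    show "inj_on (\<lambda>(i, j). biscale \<omega> 1 [^]\<^bsub>perm_group\<^esub> i \<otimes>\<^bsub>perm_group\<^esub> biscale 1 \<omega> [^]\<^bsub>perm_group\<^esub> j)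
      ({..<M} \<times> {..<M})"
      using w0 w(3)
      by (auto simp: inj_on_def biscale_pow biscale_mult biscale_eq_iff simp del: perm_group_simps(2))
  qed
qed

text \<open>The torus whose lattice is spanned by \<open>(M, M)\<close> and \<open>(M, -M)\<close>; the coordinates are \<open>zw\<close> and
  \<open>z cnj w\<close> in terms of the coordinates \<open>(z, w)\<close> of the previous model with \<open>2M\<close> in place of \<open>M\<close>.\<close>

lemma diagonal_torus_model:
  fixes M :: nat
  assumes "M > 0"
  obtains \<alpha> \<beta> \<gamma> :: "complex \<times> complex \<Rightarrow> complex \<times> complex" and \<tau>1 \<tau>2 where
    "square_tessellation perm_group \<alpha> \<beta> \<gamma>"
    "\<tau>1 = \<alpha> \<otimes>\<^bsub>perm_group\<^esub> \<beta> \<otimes>\<^bsub>perm_group\<^esub> \<gamma> \<otimes>\<^bsub>perm_group\<^esub> \<beta>"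
    "\<tau>2 = \<beta> \<otimes>\<^bsub>perm_group\<^esub> \<alpha> \<otimes>\<^bsub>perm_group\<^esub> \<beta> \<otimes>\<^bsub>perm_group\<^esub> \<gamma>"
    "(\<tau>1 \<otimes>\<^bsub>perm_group\<^esub> \<tau>2) [^]\<^bsub>perm_group\<^esub> M = \<one>\<^bsub>perm_group\<^esub>"
    "inj_on (\<lambda>(i, j). \<tau>1 [^]\<^bsub>perm_group\<^esub> i \<otimes>\<^bsub>perm_group\<^esub> (\<tau>1 \<otimes>\<^bsub>perm_group\<^esub> \<tau>2) [^]\<^bsub>perm_group\<^esub> j)
      ({..<2 * M} \<times> {..<M})"
proof -
  have "2 * M > 0" using assms by simp
  then obtain \<omega> where w: "\<omega> * cnj \<omega> = 1" "\<And>k. \<omega> ^ k = 1 \<longleftrightarrow> 2 * M dvd k"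
    "\<And>k l. k < 2 * M \<Longrightarrow> l < 2 * M \<Longrightarrow> \<omega> ^ k = \<omega> ^ l \<Longrightarrow> k = l"
    using primitive_root_of_unity by metis
  have w0: "\<omega> \<noteq> 0" using w(1) by auto
  note w2 = unit_complex_cancel[OF w(1)]
  \<comment> \<open>The generators of the rectangular model in the new coordinates: swapping
    \<open>z\<close> and \<open>w\<close>, for instance, fixes \<open>z * w\<close> and conjugates
    \<open>z * cnj w\<close>.\<close>
  define \<alpha> \<beta> \<gamma> where "\<alpha> = (\<lambda>(z, w). (cnj w, cnj z))"
    and "\<beta> = (\<lambda>(z :: complex, w). (z, cnj w))"
    and "\<gamma> = (\<lambda>(z, w). (cnj \<omega> * w, \<omega> * z))"
  note defs = \<alpha>_def \<beta>_def \<gamma>_def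
  have inv: "\<alpha> \<circ> \<alpha> = id" "\<beta> \<circ> \<beta> = id" "\<gamma> \<circ> \<gamma> = id"
    by (auto simp: defs fun_eq_iff w2)
  have bij [simp]: "bij \<alpha>" "bij \<beta>" "bij \<gamma>"
    using inv by (auto intro: o_bij)
  note [simp] = bij_comp bij
  have t1: "\<alpha> \<otimes>\<^bsub>perm_group\<^esub> \<beta> \<otimes>\<^bsub>perm_group\<^esub> \<gamma> \<otimes>\<^bsub>perm_group\<^esub> \<beta> = biscale \<omega> \<omega>"
    and t2: "\<beta> \<otimes>\<^bsub>perm_group\<^esub> \<alpha> \<otimes>\<^bsub>perm_group\<^esub> \<beta> \<otimes>\<^bsub>perm_group\<^esub> \<gamma> = biscale \<omega> (cnj \<omega>)"
    by (simp_all, simp_all add: fun_eq_iff biscale_apply defs)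
  \<comment> \<open>As \<open>\<omega>\<close> has order \<open>2 * M\<close>, this product has
    order \<open>M\<close>, while \<open>\<tau>1\<close> has order \<open>2 * M\<close>: hence the
    two ranges of exponents.\<close>
  have t12: "biscale \<omega> \<omega> \<otimes>\<^bsub>perm_group\<^esub> biscale \<omega> (cnj \<omega>) = biscale (\<omega> ^ 2) 1"
    using w0 w(1) by (simp add: biscale_mult power2_eq_square del: perm_group_simps(2))
  show thesis
  proof (rule that[OF _ t1[symmetric] t2[symmetric]])
    show "square_tessellation perm_group \<alpha> \<beta> \<gamma>"
      by unfold_locales
        (simp_all add: eval_nat_numeral inv, simp_all add: fun_eq_iff defs w2)
    have "(\<omega> ^ 2) ^ M = 1" by (simp add: power_mult[symmetric] w(2))
    then show "(biscale \<omega> \<omega> \<otimes>\<^bsub>perm_group\<^esub> biscale \<omega> (cnj \<omega>)) [^]\<^bsub>perm_group\<^esub> M = \<one>\<^bsub>perm_group\<^esub>"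
      unfolding t12 using w0 by (simp add: biscale_pow biscale_apply fun_eq_iff)
    show "inj_on (\<lambda>(i, j). biscale \<omega> \<omega> [^]\<^bsub>perm_group\<^esub> i \<otimes>\<^bsub>perm_group\<^esub>
        (biscale \<omega> \<omega> \<otimes>\<^bsub>perm_group\<^esub> biscale \<omega> (cnj \<omega>)) [^]\<^bsub>perm_group\<^esub> j)
      ({..<2 * M} \<times> {..<M})"
    proof (rule inj_onI, unfold split_paired_all prod.case)
      fix i j k l :: nat
      assume lt: "(i, j) \<in> {..<2 * M} \<times> {..<M}" "(k, l) \<in> {..<2 * M} \<times> {..<M}"
        and eq: "biscale \<omega> \<omega> [^]\<^bsub>perm_group\<^esub> i \<otimes>\<^bsub>perm_group\<^esub>
          (biscale \<omega> \<omega> \<otimes>\<^bsub>perm_group\<^esub> biscale \<omega> (cnj \<omega>)) [^]\<^bsub>perm_group\<^esub> j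
        = biscale \<omega> \<omega> [^]\<^bsub>perm_group\<^esub> k \<otimes>\<^bsub>perm_group\<^esub>
          (biscale \<omega> \<omega> \<otimes>\<^bsub>perm_group\<^esub> biscale \<omega> (cnj \<omega>)) [^]\<^bsub>perm_group\<^esub> l"
      have "biscale (\<omega> ^ i * (\<omega> ^ 2) ^ j) (\<omega> ^ i) = biscale (\<omega> ^ k * (\<omega> ^ 2) ^ l) (\<omega> ^ k)"
        using eq w0 unfolding t12
        by (simp add: biscale_pow biscale_mult del: perm_group_simps(2))
      then have eq: "\<omega> ^ i * (\<omega> ^ 2) ^ j = \<omega> ^ k * (\<omega> ^ 2) ^ l \<and> \<omega> ^ i = \<omega> ^ k"
        unfolding biscale_eq_iff .
      then have "i = k" using lt w(3) by simp
      with eq w0 have "(\<omega> ^ 2) ^ j = (\<omega> ^ 2) ^ l" by simp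
      then have "\<omega> ^ (2 * j) = \<omega> ^ (2 * l)" by (simp only: power_mult)
      then show "(i, j) = (k, l)" using \<open>i = k\<close> w(3)[of "2 * j" "2 * l"] lt by simp
    qed
  qed
qed

text \<open>Symmetric difference with \<open>{i}\<close>. A product of toggles sends the empty set
  to the set of indices that occur an odd number of times.\<close>

definition toggle :: "nat \<Rightarrow> nat set \<Rightarrow> nat set" where
  "toggle i A = (if i \<in> A then A - {i} else insert i A)"

lemma toggle_simps:
  "toggle i \<circ> toggle i = id" "toggle i \<circ> toggle j = toggle j \<circ> toggle i"
  by (auto simp: toggle_def fun_eq_iff)

lemma bij_toggle: "bij (toggle i)"
  by (rule o_bij[of "toggle i"]) (simp_all add: toggle_simps)

section \<open>The normal form\<close>

lemma (in group) pow_inj_of_order: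
  assumes y: "y \<in> carrier G" and ord: "\<And>k. y [^] (k::nat) = \<one> \<longleftrightarrow> M dvd k"
    and eq: "y [^] (i::nat) = y [^] (j::nat)" and "i < M" "j < M"
  shows "i = j"
proof -
  have "i = j" if "i \<le> j" "i < M" "j < M" "y [^] i = y [^] j" for i j :: nat
  proof -
    have "y [^] i \<otimes> y [^] (j - i) = y [^] (i + (j - i))" by (rule nat_pow_mult[OF y])
    also have "\<dots> = y [^] i" using that by simp
    finally have "y [^] (j - i) = \<one>" using y by simp
    then have "M dvd j - i" using ord by simp
    then show "i = j" using that by (auto dest: dvd_imp_le)
  qed
  then show ?thesis using assms by (metis nat_le_linear)
qed

text \<open>If \<open>e\<close> and \<open>f\<close> differ, cancellation makes \<open>b\<close> a
  power of \<open>x\<close>, with exponent \<open>(M - 1) * j\<close> serving for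
  \<open>- j\<close>; this contradicts \<open>not\<close>. Otherwise the powers of \<open>x\<close>
  agree.\<close>

lemma (in group) pow_involution_inj:
  assumes x: "x \<in> carrier G" and b: "b \<in> carrier G" and bb: "b \<otimes> b = \<one>"
    and ord: "\<And>k. x [^] (k::nat) = \<one> \<longleftrightarrow> M dvd k" and M: "M > 0"
    and not: "\<And>k. x [^] (k::nat) \<noteq> b"
    and eq: "x [^] (i::nat) \<otimes> b [^] (e::nat) = x [^] (j::nat) \<otimes> b [^] (f::nat)"
    and "i < M" "j < M" "e < 2" "f < 2"
  shows "i = j \<and> e = f"
proof -
  have *: False if "x [^] (i::nat) = x [^] (j::nat) \<otimes> b" for i j
  proof -
    have "x [^] ((M - 1) * j) \<otimes> x [^] j = x [^] (M * j)"
      using x M by (simp add: nat_pow_mult diff_mult_distrib)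
    also have "\<dots> = \<one>" using ord by simp
    finally have inv: "x [^] ((M - 1) * j) \<otimes> x [^] j = \<one>" .
    have "x [^] ((M - 1) * j + i) = x [^] ((M - 1) * j) \<otimes> (x [^] j \<otimes> b)"
      using x that by (simp add: nat_pow_mult[symmetric])
    also have "\<dots> = b" using x b inv by (simp add: m_assoc[symmetric])
    finally show False using not by blast
  qed
  have "(e = 0 \<or> e = 1) \<and> (f = 0 \<or> f = 1)" using assms by auto
  moreover have "i = j" if "x [^] i = x [^] j"
    using pow_inj_of_order[OF x ord that] assms by simp
  ultimately show ?thesis using eq x b *[of i j] *[of j i] by auto
qed

section \<open>The translation lattice under the two forms of the extra relator\<close>

context square_tessellation_group
begin

text \<open>\<open>t1\<close> is the conjugate of \<open>t2\<close> by \<open>b\<close>, so its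
  power \<open>M\<close> is trivial as well.\<close>

lemma rectangular_lattice:
  assumes "t2 [^] (M::nat) = \<one>" "M > 0" "g \<in> generate G {t1, t2}"
  obtains k l where "k < M" "l < M" "g = t1 [^] k \<otimes> t2 [^] l"
proof -
  have pow: "(b \<otimes> t2 \<otimes> b) [^] (k::nat) = b \<otimes> t2 [^] k \<otimes> b" for k
    by (induction k) (simp_all add: m_assoc)
  have "t1 [^] M = \<one>" using pow[of M] assms(1) by (simp add: translations_conj)
  then show thesis
    using that assms translations_commute by (elim generate_commuting_pair[rotated 7]) auto
qed

text \<open>Conjugation by \<open>a\<close> turns \<open>t1 \<otimes> t2\<close> into
  \<open>inv t1 \<otimes> t2\<close>, whose power \<open>M\<close> is therefore trivial too. So
  \<open>t1 [^] M\<close> equals both \<open>t2 [^] M\<close> and its inverse, and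
  \<open>t1 [^] (2 * M)\<close> is trivial; \<open>t1\<close> and \<open>t1 \<otimes> t2\<close>
  generate the same lattice as \<open>t1\<close> and \<open>t2\<close>.\<close>

lemma diagonal_lattice:
  assumes M: "(t1 \<otimes> t2) [^] (M::nat) = \<one>" "M > 0" and g: "g \<in> generate G {t1, t2}"
  obtains k l where "k < 2 * M" "l < M" "g = t1 [^] k \<otimes> (t1 \<otimes> t2) [^] l"
proof -
  have cl: "t1 \<in> carrier G" "t2 \<in> carrier G" by auto
  have comm: "t2 \<otimes> t1 = t1 \<otimes> t2" by (rule translations_commute)
  have pow: "(a \<otimes> (t1 \<otimes> t2) \<otimes> a) [^] (k::nat) = a \<otimes> (t1 \<otimes> t2) [^] k \<otimes> a" for k
    by (induction k) (simp_all add: m_assoc)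
  have "a \<otimes> (t1 \<otimes> t2) \<otimes> a = (a \<otimes> t1 \<otimes> a) \<otimes> (a \<otimes> t2 \<otimes> a)" by (simp add: m_assoc)
  then have conj: "a \<otimes> (t1 \<otimes> t2) \<otimes> a = inv t1 \<otimes> t2" by (simp only: translations_conj)
  have "(inv t1 \<otimes> t2) [^] M = \<one>" using pow[of M] M by (simp add: conj)
  moreover have "inv t1 \<otimes> t2 = t2 \<otimes> inv t1"
    using comm cl by (metis inv_closed inv_solve_left inv_solve_right m_assoc m_closed)
  then have "(inv t1 \<otimes> t2) [^] M = inv t1 [^] M \<otimes> t2 [^] M"
    by (rule pow_mult_distrib) (use cl in auto)
  ultimately have "inv (t1 [^] M) \<otimes> t2 [^] M = \<one>"
    using cl by (simp only: nat_pow_inv)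
  moreover have "t1 [^] M \<otimes> t2 [^] M = \<one>"
    using M(1) cl comm by (simp add: pow_mult_distrib)
  ultimately have "t1 [^] M = inv (t2 [^] M)" "t2 [^] M = t1 [^] M"
    using cl by (metis inv_equality nat_pow_closed, metis inv_equality inv_inv inv_closed nat_pow_closed)
  then have "t1 [^] M \<otimes> t1 [^] M = \<one>" using cl by (metis nat_pow_closed r_inv)
  then have t1: "t1 [^] (2 * M) = \<one>" using cl by (simp add: nat_pow_mult mult_2)
  have "{t1, t2} \<subseteq> generate G {t1, t1 \<otimes> t2}"
  proof -
    have "inv t1 \<otimes> (t1 \<otimes> t2) \<in> generate G {t1, t1 \<otimes> t2}"
      by (rule generate.eng) (auto intro: generate.incl generate.inv)
    moreover have "inv t1 \<otimes> (t1 \<otimes> t2) = t2" using cl by (simp only: m_assoc[symmetric] inv_closed l_inv l_one)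
    ultimately show ?thesis by (auto intro: generate.incl)
  qed
  then have "g \<in> generate G {t1, t1 \<otimes> t2}"
    using g cl generate_subgroup_incl[OF _ generate_is_subgroup[of "{t1, t1 \<otimes> t2}"]] by blast
  moreover have "t1 \<otimes> t2 \<otimes> t1 = t1 \<otimes> (t1 \<otimes> t2)" using comm cl by (simp only: m_assoc)
  moreover have "0 < 2 * M" using M(2) by simp
  ultimately show thesis
    using generate_commuting_pair[OF cl(1) m_closed[OF cl] _ t1 _ M] that by blast
qed

end

text \<open>The common relators as relations between generators. The extra relator enters
  separately, through the translation lattice, so that both parities share what follows.\<close>

locale relators_group = string_group +
  fixes s t l1 l2 :: nat
  assumes s_ge2: "s \<ge> 2" and t_ge2: "t \<ge> 2" and l_pos: "l1 > 0" "l2 > 0"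
    and ab_pow: "(a \<otimes> b) [^] (2 ^ s * l1) = \<one>"
    and bc_pow: "(b \<otimes> c) [^] (2 ^ t * l2) = \<one>"
    and ab4_comm: "c \<otimes> (a \<otimes> b) [^] (4::nat) = (a \<otimes> b) [^] (4::nat) \<otimes> c"
    and bc4_comm: "a \<otimes> (b \<otimes> c) [^] (4::nat) = (b \<otimes> c) [^] (4::nat) \<otimes> a"
begin

abbreviation (input) p where "p \<equiv> (a \<otimes> b) [^] (4::nat)"
abbreviation (input) q where "q \<equiv> (b \<otimes> c) [^] (4::nat)"
text \<open>Exponents for \<open>p\<close> and \<open>q\<close>: one quarter of those of
  \<open>a \<otimes> b\<close> and \<open>b \<otimes> c\<close>, exact because \<open>s\<close> and
  \<open>t\<close> are at least 2.\<close>

abbreviation (input) P where "P \<equiv> 2 ^ (s - 2) * l1"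
abbreviation (input) Q where "Q \<equiv> 2 ^ (t - 2) * l2"

lemma four_P: "4 * P = 2 ^ s * l1" and four_Q: "4 * Q = 2 ^ t * l2"
proof -
  have "(2::nat) ^ s = 2 ^ 2 * 2 ^ (s - 2)" "(2::nat) ^ t = 2 ^ 2 * 2 ^ (t - 2)"
    using s_ge2 t_ge2 by (simp_all only: power_add[symmetric] le_add_diff_inverse)
  then show "4 * P = 2 ^ s * l1" "4 * Q = 2 ^ t * l2" by simp_all
qed

lemma p_pow: "p [^] P = \<one>" and q_pow: "q [^] Q = \<one>"
  by (simp_all only: nat_pow_pow m_closed a_closed b_closed c_closed four_P four_Q ab_pow bc_pow)

lemma pq_conj:
  "a \<otimes> p \<otimes> a = inv p" "b \<otimes> p \<otimes> b = inv p" "c \<otimes> p \<otimes> c = p"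
  "a \<otimes> q \<otimes> a = q" "b \<otimes> q \<otimes> b = inv q" "c \<otimes> q \<otimes> c = inv q"
proof -
  show "c \<otimes> p \<otimes> c = p" "a \<otimes> q \<otimes> a = q"
    by (simp_all only: ab4_comm bc4_comm m_assoc m_closed nat_pow_closed a_closed b_closed c_closed
        a_sq c_sq r_one)
qed (simp_all add: eval_nat_numeral m_assoc inv_mult_group)

text \<open>Moving \<open>q\<close> across \<open>p\<close> letter by letter, each \<open>a\<close>
  leaves it alone and each of the four letters \<open>b\<close> inverts it, so it comes out
  unchanged.\<close>

lemma pq_comm: "q \<otimes> p = p \<otimes> q"
proof -
  \<comment> \<open>The name shields \<open>q\<close> while \<open>p\<close> is expanded into
    letters.\<close>
  define r where "r = q"
  have r: "r \<in> carrier G" unfolding r_def by simp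
  have ar: "a \<otimes> r = r \<otimes> a" unfolding r_def by (rule bc4_comm)
  have "b \<otimes> r \<otimes> b = inv r" unfolding r_def by (rule pq_conj)
  then have br: "b \<otimes> r = inv r \<otimes> b" using r by (metis b_closed b_sq m_assoc m_closed r_one)
  have ri: "x \<otimes> inv r = inv (x \<otimes> r \<otimes> x) \<otimes> x" if "x \<in> carrier G" "x \<otimes> x = \<one>" "inv x = x" for x
    using that r by (simp add: inv_mult_group m_assoc)
  have "a \<otimes> r \<otimes> a = r" unfolding r_def by (rule pq_conj)
  then have air: "a \<otimes> inv r = inv r \<otimes> a" using ri[of a] by simp
  have bir: "b \<otimes> inv r = r \<otimes> b" using ri[of b] \<open>b \<otimes> r \<otimes> b = inv r\<close> r by simp
  have left: "a \<otimes> (r \<otimes> z) = r \<otimes> (a \<otimes> z)" "a \<otimes> (inv r \<otimes> z) = inv r \<otimes> (a \<otimes> z)"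
    "b \<otimes> (r \<otimes> z) = inv r \<otimes> (b \<otimes> z)" "b \<otimes> (inv r \<otimes> z) = r \<otimes> (b \<otimes> z)" if "z \<in> carrier G" for z
    using that r ar air br bir by (simp_all add: m_assoc[symmetric])
  have "p \<otimes> r = r \<otimes> p"
    using r by (simp add: eval_nat_numeral m_assoc ar air br bir left)
  then show ?thesis unfolding r_def by simp
qed

lemma N_normal: "generate G {p, q} \<lhd> G"
  by (rule normal_generate_conj) (auto simp: pq_conj intro: generate.incl generate.inv)

lemma N_commute: "x \<in> generate G {p, q} \<Longrightarrow> y \<in> generate G {p, q} \<Longrightarrow> x \<otimes> y = y \<otimes> x"
  by (rule generate_pairwise_commuting[of "{p, q}"]) (use pq_comm in auto)

lemma tessellation_quotient:
  obtains T :: "'a set monoid" and h where "group_hom G T h" "h ` carrier G = carrier T"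
    "kernel G T h = generate G {p, q}" "square_tessellation_group T (h a) (h b) (h c)"
proof -
  obtain T :: "'a set monoid" and h where h: "group_hom G T h" "h ` carrier G = carrier T"
    "kernel G T h = generate G {p, q}"
    by (rule quotient_map[OF N_normal])
  interpret h: group_hom G T h by (rule h(1))
  interpret T: string_group T "h a" "h b" "h c"
    by (rule string_group_image[OF h(1,2)])
  have "h p = \<one>\<^bsub>T\<^esub>" "h q = \<one>\<^bsub>T\<^esub>"
    by (rule h.kernelD, simp add: h(3) generate.incl)+
  then have "square_tessellation_group T (h a) (h b) (h c)"
    by unfold_locales (simp_all add: h.hom_nat_pow)
  with h show thesis using that by blast
qed

lemma relators_solvable: "solvable G"
proof -
  obtain T :: "'a set monoid" and h where h: "group_hom G T h" "h ` carrier G = carrier T"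
    "kernel G T h = generate G {p, q}" "square_tessellation_group T (h a) (h b) (h c)"
    by (rule tessellation_quotient)
  interpret h: group_hom G T h by (rule h(1))
  interpret T: square_tessellation_group T "h a" "h b" "h c" by (rule h(4))
  show ?thesis
    by (rule h.solvable_abelian_kernel[OF h(2) _ T.tessellation_solvable]) (simp add: h(3) N_commute)
qed

text \<open>In the tessellation quotient an element is a translation times an element of the group
  generated by the images of \<open>a\<close> and \<open>b\<close>; lifting both leaves an error in
  the kernel, the group of \<open>p\<close> and \<open>q\<close>. The assumption
  \<open>lattice\<close> covers both parities: \<open>v\<close> will be \<open>t2\<close> or
  \<open>t1 \<otimes> t2\<close>.\<close>

lemma normal_form:
  assumes v: "v \<in> carrier G"
    and lattice: "\<And>(T :: 'a set monoid) h g. \<lbrakk>group_hom G T h; square_tessellation_group T (h a) (h b) (h c);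
        g \<in> generate T {h t1, h t2}\<rbrakk> \<Longrightarrow>
      \<exists>k<A. \<exists>l<B. g = h t1 [^]\<^bsub>T\<^esub> (k::nat) \<otimes>\<^bsub>T\<^esub> h v [^]\<^bsub>T\<^esub> (l::nat)"
    and g: "g \<in> carrier G"
  obtains i j k l e f where "i < P" "j < Q" "k < A" "l < B" "e < (4::nat)" "f < (2::nat)"
    "g = (p [^] i \<otimes> q [^] j) \<otimes> ((t1 [^] k \<otimes> v [^] l) \<otimes> ((a \<otimes> b) [^] e \<otimes> b [^] f))"
proof -
  obtain T :: "'a set monoid" and h where h: "group_hom G T h" "h ` carrier G = carrier T"
    "kernel G T h = generate G {p, q}" "square_tessellation_group T (h a) (h b) (h c)"
    by (rule tessellation_quotient)
  interpret h: group_hom G T h by (rule h(1))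
  interpret T: square_tessellation_group T "h a" "h b" "h c" by (rule h(4))
  have "h g \<in> carrier T" using g by simp
  then obtain y d where y: "y \<in> generate T {h t1, h t2}" and d: "d \<in> generate T {h a, h b}"
    and hg: "h g = y \<otimes>\<^bsub>T\<^esub> d"
    by (rule T.translations_normal_form) simp
  obtain k l where kl: "k < A" "l < B" "y = h t1 [^]\<^bsub>T\<^esub> k \<otimes>\<^bsub>T\<^esub> h v [^]\<^bsub>T\<^esub> l"
    using lattice[OF h(1,4) y] by blast
  obtain e f :: nat where ef: "e < 4" "f < 2" "d = (h a \<otimes>\<^bsub>T\<^esub> h b) [^]\<^bsub>T\<^esub> e \<otimes>\<^bsub>T\<^esub> h b [^]\<^bsub>T\<^esub> (f::nat)"
    by (rule h.H.generate_involution_pair[OF _ _ T.a_sq T.b_sq T.ab4 _ d]) auto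
  let ?w = "(t1 [^] k \<otimes> v [^] l) \<otimes> ((a \<otimes> b) [^] e \<otimes> b [^] f)"
  have "h g = h ?w" using v by (simp add: hg kl(3) ef(3) h.hom_nat_pow)
  then obtain z where z: "z \<in> generate G {p, q}" "g = z \<otimes> ?w"
    using h.eq_imp_mult_kernel[of g ?w] g v h(3) by auto
  have "0 < P" "0 < Q" using l_pos by auto
  then obtain i j where "i < P" "j < Q" "z = p [^] i \<otimes> q [^] j"
    using generate_commuting_pair[OF _ _ pq_comm p_pow _ q_pow _ z(1)] by auto
  with z kl ef show thesis using that by blast
qed

text \<open>Each homomorphism separates one layer of the normal form: \<open>h3\<close> the dihedral
  part of order 8, \<open>w\<close> the translations, \<open>h1\<close> the exponent of
  \<open>p\<close>, \<open>h2\<close> that of \<open>q\<close>. They are applied in this order, and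
  each layer is cancelled once it is known.\<close>

lemma order_formula:
  fixes v A B and D1 :: "('d1, 'e1) monoid_scheme" and D2 :: "('d2, 'e2) monoid_scheme"
    and D3 :: "('d3, 'e3) monoid_scheme" and W :: "('d4, 'e4) monoid_scheme"
  assumes v: "v \<in> carrier G"
    and lattice: "\<And>(T :: 'a set monoid) h g. \<lbrakk>group_hom G T h; square_tessellation_group T (h a) (h b) (h c);
        g \<in> generate T {h t1, h t2}\<rbrakk> \<Longrightarrow>
      \<exists>k<A. \<exists>l<B. g = h t1 [^]\<^bsub>T\<^esub> (k::nat) \<otimes>\<^bsub>T\<^esub> h v [^]\<^bsub>T\<^esub> (l::nat)"
    and h1: "group_hom G D1 h1" "h1 c = \<one>\<^bsub>D1\<^esub>"
      "\<And>k. h1 (a \<otimes> b) [^]\<^bsub>D1\<^esub> (k::nat) = \<one>\<^bsub>D1\<^esub> \<longleftrightarrow> 2 ^ s * l1 dvd k"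
    and h2: "group_hom G D2 h2" 
      "\<And>k. h2 (b \<otimes> c) [^]\<^bsub>D2\<^esub> (k::nat) = \<one>\<^bsub>D2\<^esub> \<longleftrightarrow> 2 ^ t * l2 dvd k"
    and h3: "group_hom G D3 h3" "h3 q = \<one>\<^bsub>D3\<^esub>" "h3 t1 = \<one>\<^bsub>D3\<^esub>" "h3 v = \<one>\<^bsub>D3\<^esub>"
      "\<And>k. h3 (a \<otimes> b) [^]\<^bsub>D3\<^esub> (k::nat) = \<one>\<^bsub>D3\<^esub> \<longleftrightarrow> 4 dvd k"
      "\<And>k. h3 (a \<otimes> b) [^]\<^bsub>D3\<^esub> (k::nat) \<noteq> h3 b"
    and w: "group_hom G W w" "w p = \<one>\<^bsub>W\<^esub>" "w q = \<one>\<^bsub>W\<^esub>"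
      "inj_on (\<lambda>(i, j). w t1 [^]\<^bsub>W\<^esub> i \<otimes>\<^bsub>W\<^esub> w v [^]\<^bsub>W\<^esub> j) ({..<A :: nat} \<times> {..<B :: nat})"
  shows "order G = P * Q * A * B * 8"
proof -
  interpret h1: group_hom G D1 h1 by (rule h1)
  interpret h2: group_hom G D2 h2 by (rule h2)
  interpret h3: group_hom G D3 h3 by (rule h3)
  interpret w: group_hom G W w by (rule w)
  define nf where "nf = (\<lambda>(i :: nat, j :: nat, k :: nat, l :: nat, e :: nat, f :: nat).
    (p [^] i \<otimes> q [^] j) \<otimes> ((t1 [^] k \<otimes> v [^] l) \<otimes> ((a \<otimes> b) [^] e \<otimes> b [^] f)))"
  let ?X = "{..<P} \<times> {..<Q} \<times> {..<A} \<times> {..<B} \<times> {..<4::nat} \<times> {..<2::nat}"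
  have bsq: "h3 b \<otimes>\<^bsub>D3\<^esub> h3 b = \<one>\<^bsub>D3\<^esub>" by (simp flip: h3.hom_mult)
  have h1b: "h1 b [^]\<^bsub>D1\<^esub> (4::nat) = \<one>\<^bsub>D1\<^esub>"
    by (simp flip: h1.hom_nat_pow) (simp add: eval_nat_numeral m_assoc)
  have h1q: "h1 q = \<one>\<^bsub>D1\<^esub>" by (simp add: h1.hom_nat_pow h1(2) h1b)
  have h3p: "h3 p = \<one>\<^bsub>D3\<^esub>" using h3(5)[of 4] by (simp add: h3.hom_nat_pow)
  have "inj_on nf ?X"
  proof (rule inj_onI, clarsimp simp del: One_nat_def)
    fix i j k l e f i' j' k' l' e' f' :: nat
    assume lt: "i < P" "j < Q" "k < A" "l < B" "e < 4" "f < 2"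
      "i' < P" "j' < Q" "k' < A" "l' < B" "e' < 4" "f' < 2"
    let ?pq = "\<lambda>i j. p [^] i \<otimes> q [^] j" and ?tv = "\<lambda>k l. t1 [^] k \<otimes> v [^] l"
      and ?d = "\<lambda>e f. (a \<otimes> b) [^] e \<otimes> b [^] f"
    have cl: "?pq i j \<in> carrier G" "?tv k l \<in> carrier G" "?d e f \<in> carrier G"
      for i j k l e f :: nat using v by auto
    assume "nf (i, j, k, l, e, f) = nf (i', j', k', l', e', f')"
    then have eq: "?pq i j \<otimes> (?tv k l \<otimes> ?d e f) = ?pq i' j' \<otimes> (?tv k' l' \<otimes> ?d e' f')"
      by (simp only: nf_def prod.case)
    have cl': "t1 \<in> carrier G" "p \<in> carrier G" "q \<in> carrier G" "a \<otimes> b \<in> carrier G" by auto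
    have h3_pow: "h3 (p [^] i) = \<one>\<^bsub>D3\<^esub>" "h3 (q [^] i) = \<one>\<^bsub>D3\<^esub>"
      "h3 (t1 [^] i) = \<one>\<^bsub>D3\<^esub>" "h3 (v [^] i) = \<one>\<^bsub>D3\<^esub>" for i :: nat
      using h3p h3(2-4) by (simp_all only: h3.hom_nat_pow[OF v] h3.hom_nat_pow[OF cl'(1)]
          h3.hom_nat_pow[OF cl'(2)] h3.hom_nat_pow[OF cl'(3)] h3.H.nat_pow_one)
    have "h3 (?pq i j \<otimes> (?tv k l \<otimes> ?d e f)) = h3 (?d e f)" for i j k l e f :: nat
      by (simp only: h3.hom_mult h3_pow v cl' b_closed m_closed nat_pow_closed h3.hom_closed
          h3.H.m_closed h3.H.l_one h3.H.one_closed)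
    then have "h3 (?d e f) = h3 (?d e' f')" using eq by metis
    then have ef: "e = e' \<and> f = f'"
      using lt by (intro h3.H.pow_involution_inj[OF _ _ bsq h3(5) _ h3(6)]) (auto simp: h3.hom_nat_pow)
    have eq: "?pq i j \<otimes> ?tv k l = ?pq i' j' \<otimes> ?tv k' l'"
      using eq cl ef by (simp only: m_assoc[symmetric] m_closed right_cancel)
    have w_pow: "w (p [^] i) = \<one>\<^bsub>W\<^esub>" "w (q [^] i) = \<one>\<^bsub>W\<^esub>" for i :: nat
      using w(2,3) by (simp_all only: w.hom_nat_pow[OF cl'(2)] w.hom_nat_pow[OF cl'(3)] w.H.nat_pow_one)
    have "w (?pq i j \<otimes> ?tv k l) = w (?tv k l)" for i j k l :: nat
      by (simp only: w.hom_mult w_pow v cl' m_closed nat_pow_closed w.hom_closed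
          w.H.m_closed w.H.l_one w.H.one_closed)
    then have "w (?tv k l) = w (?tv k' l')" using eq by metis
    then have "w t1 [^]\<^bsub>W\<^esub> k \<otimes>\<^bsub>W\<^esub> w v [^]\<^bsub>W\<^esub> l = w t1 [^]\<^bsub>W\<^esub> k' \<otimes>\<^bsub>W\<^esub> w v [^]\<^bsub>W\<^esub> l'"
      by (simp only: w.hom_mult w.hom_nat_pow v cl'(1) nat_pow_closed)
    then have kl: "k = k' \<and> l = l'"
      using inj_onD[OF w(4), of "(k, l)" "(k', l')"] lt by simp
    have eq: "?pq i j = ?pq i' j'"
      using eq cl kl by (simp only: right_cancel)
    have h1_pow: "h1 (p [^] i) = h1 (a \<otimes> b) [^]\<^bsub>D1\<^esub> (4 * i)" "h1 (q [^] i) = \<one>\<^bsub>D1\<^esub>" for i :: nat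
      by (simp_all only: nat_pow_pow[OF cl'(4)] h1.hom_nat_pow[OF cl'(4)] h1.hom_nat_pow[OF cl'(3)]
          h1q h1.H.nat_pow_one)
    have "h1 (?pq i j) = h1 (a \<otimes> b) [^]\<^bsub>D1\<^esub> (4 * i)" for i j :: nat
      using cl' by (simp only: h1.hom_mult[OF nat_pow_closed nat_pow_closed] h1_pow h1.H.r_one
          h1.H.nat_pow_closed h1.hom_closed)
    then have "h1 (a \<otimes> b) [^]\<^bsub>D1\<^esub> (4 * i) = h1 (a \<otimes> b) [^]\<^bsub>D1\<^esub> (4 * i')" using eq by metis
    then have "4 * i = 4 * i'"
      using lt by (intro h1.H.pow_inj_of_order[OF _ h1(3)]) (simp_all only: four_P[symmetric], auto)
    then have i: "i = i'" by simp
    \<comment> \<open>The factor with \<open>p\<close> is now cancelled, so \<open>h2\<close> is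
      applied to a power of \<open>q\<close> alone.\<close>
    then have "q [^] j = q [^] j'" using eq by simp
    then have "h2 (q [^] j) = h2 (q [^] j')" by (rule arg_cong)
    then have "h2 (b \<otimes> c) [^]\<^bsub>D2\<^esub> (4 * j) = h2 (b \<otimes> c) [^]\<^bsub>D2\<^esub> (4 * j')"
      by (simp add: h2.hom_nat_pow h2.H.nat_pow_pow)
    then have "4 * j = 4 * j'"
      using lt by (intro h2.H.pow_inj_of_order[OF _ h2(2)]) (simp_all only: four_Q[symmetric], auto)
    with i ef kl show "i = i' \<and> j = j' \<and> k = k' \<and> l = l' \<and> e = e' \<and> f = f'" by simp
  qed
  moreover have "nf ` ?X = carrier G"
  proof
    show "nf ` ?X \<subseteq> carrier G" using v by (auto simp: nf_def)
    show "carrier G \<subseteq> nf ` ?X"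
    proof
      fix g assume g: "g \<in> carrier G"
      obtain i j k l e f :: nat where
        *: "i < P" "j < Q" "k < A" "l < B" "e < 4" "f < 2"
        "g = (p [^] i \<otimes> q [^] j) \<otimes> ((t1 [^] k \<otimes> v [^] l) \<otimes> ((a \<otimes> b) [^] e \<otimes> b [^] f))"
        by (rule normal_form[where A = A and B = B, OF v _ g], erule (2) lattice) blast
      then have "g = nf (i, j, k, l, e, f)" "(i, j, k, l, e, f) \<in> ?X" by (simp_all add: nf_def)
      then show "g \<in> nf ` ?X" by (rule image_eqI)
    qed
  qed
  ultimately have "bij_betw nf ?X (carrier G)" by (simp add: bij_betw_def)
  then have "card ?X = order G" unfolding order_def by (rule bij_betw_same_card)
  then show ?thesis by (simp add: card_cartesian_product mult_ac)
qed

end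

section \<open>The kernel of the point group map and bounds for the translations\<close>

context relators_group
begin

text \<open>When \<open>c\<close> maps to the image of \<open>b \<otimes> a \<otimes> b\<close>, the
  products \<open>b \<otimes> c\<close> and \<open>a \<otimes> b\<close> have the same image, and
  the words \<open>t1\<close> and \<open>t2\<close> cancel completely.\<close>

lemma point_group_kernel:
  assumes h: "group_hom G H h" "h c = h b \<otimes>\<^bsub>H\<^esub> h a \<otimes>\<^bsub>H\<^esub> h b"
    and pow: "h (a \<otimes> b) [^]\<^bsub>H\<^esub> (4::nat) = \<one>\<^bsub>H\<^esub>"
  shows "h q = \<one>\<^bsub>H\<^esub>" "h t1 = \<one>\<^bsub>H\<^esub>" "h t2 = \<one>\<^bsub>H\<^esub>" "h (t1 \<otimes> t2) = \<one>\<^bsub>H\<^esub>"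
proof -
  interpret h: group_hom G H h by (rule h)
  have sq: "h a \<otimes>\<^bsub>H\<^esub> h a = \<one>\<^bsub>H\<^esub>" "h b \<otimes>\<^bsub>H\<^esub> h b = \<one>\<^bsub>H\<^esub>"
    by (simp_all flip: h.hom_mult)
  have cancel: "h a \<otimes>\<^bsub>H\<^esub> (h a \<otimes>\<^bsub>H\<^esub> z) = z" "h b \<otimes>\<^bsub>H\<^esub> (h b \<otimes>\<^bsub>H\<^esub> z) = z" if "z \<in> carrier H" for z
    using that sq by (simp_all add: h.H.m_assoc[symmetric])
  have "h (b \<otimes> c) = h (a \<otimes> b)" by (simp add: h(2) h.H.m_assoc cancel)
  then show "h q = \<one>\<^bsub>H\<^esub>" using pow by (simp only: h.hom_nat_pow b_closed c_closed m_closed)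
  show t: "h t1 = \<one>\<^bsub>H\<^esub>" "h t2 = \<one>\<^bsub>H\<^esub>" by (simp_all add: h(2) h.H.m_assoc cancel sq)
  have "h (t1 \<otimes> t2) = h t1 \<otimes>\<^bsub>H\<^esub> h t2" by (rule h.hom_mult) auto
  then show "h (t1 \<otimes> t2) = \<one>\<^bsub>H\<^esub>" unfolding t by simp
qed

context
  fixes T :: "('t, 'u) monoid_scheme" and h g
  assumes h: "group_hom G T h" "square_tessellation_group T (h a) (h b) (h c)"
    and g: "g \<in> generate T {h t1, h t2}"
begin

interpretation h: group_hom G T h by (rule h(1))
interpretation T: square_tessellation_group T "h a" "h b" "h c" by (rule h(2))

lemma image_translations: "h t1 = T.t1" "h t2 = T.t2" "h (t1 \<otimes> t2) = T.t1 \<otimes>\<^bsub>T\<^esub> T.t2"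
  by (simp_all only: h.hom_mult a_closed b_closed c_closed m_closed)

lemma rectangular_lattice_image:
  assumes "t2 [^] (M::nat) = \<one>" "M > 0"
  shows "\<exists>k<M. \<exists>l<M. g = h t1 [^]\<^bsub>T\<^esub> k \<otimes>\<^bsub>T\<^esub> h t2 [^]\<^bsub>T\<^esub> l"
proof -
  have "h t2 [^]\<^bsub>T\<^esub> M = h (t2 [^] M)" by (rule h.hom_nat_pow[symmetric]) auto
  also have "\<dots> = \<one>\<^bsub>T\<^esub>" by (simp only: assms(1) h.hom_one)
  finally have "T.t2 [^]\<^bsub>T\<^esub> M = \<one>\<^bsub>T\<^esub>" unfolding image_translations .
  then obtain k l where "k < M" "l < M" "g = T.t1 [^]\<^bsub>T\<^esub> k \<otimes>\<^bsub>T\<^esub> T.t2 [^]\<^bsub>T\<^esub> l"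
    using g unfolding image_translations by (rule T.rectangular_lattice[OF _ assms(2)])
  then show ?thesis unfolding image_translations by blast
qed

text \<open>In \<open>T\<close> the commutator becomes the square of the product of the two
  translations, so that product has exponent \<open>2 * M\<close>.\<close>

lemma diagonal_lattice_image:
  assumes "commutator G ((a \<otimes> b) [^] (2::nat)) ((b \<otimes> c) [^] (2::nat)) [^] (M::nat) = \<one>" "M > 0"
  shows "\<exists>k<2 * (2 * M). \<exists>l<2 * M. g = h t1 [^]\<^bsub>T\<^esub> k \<otimes>\<^bsub>T\<^esub> h (t1 \<otimes> t2) [^]\<^bsub>T\<^esub> l"
proof -
  let ?c = "commutator G ((a \<otimes> b) [^] (2::nat)) ((b \<otimes> c) [^] (2::nat))"
  have c: "?c \<in> carrier G" by (simp add: commutator_def)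
  have "h ?c = (T.t1 \<otimes>\<^bsub>T\<^esub> T.t2) [^]\<^bsub>T\<^esub> (2::nat)"
    using T.commutator_half_turns
    by (simp only: h.hom_commutator h.hom_nat_pow h.hom_mult a_closed b_closed c_closed m_closed
        nat_pow_closed)
  moreover have "h (?c [^] M) = h ?c [^]\<^bsub>T\<^esub> M" by (rule h.hom_nat_pow[OF c])
  ultimately have "(T.t1 \<otimes>\<^bsub>T\<^esub> T.t2) [^]\<^bsub>T\<^esub> (2 * M) = \<one>\<^bsub>T\<^esub>"
    unfolding assms(1) h.hom_one
    by (simp only: h.H.nat_pow_pow T.a_closed T.b_closed T.c_closed h.H.m_closed)
  moreover have "0 < 2 * M" using assms(2) by simp
  ultimately obtain k l where "k < 2 * (2 * M)" "l < 2 * M"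
    "g = T.t1 [^]\<^bsub>T\<^esub> k \<otimes>\<^bsub>T\<^esub> (T.t1 \<otimes>\<^bsub>T\<^esub> T.t2) [^]\<^bsub>T\<^esub> l"
    using g unfolding image_translations by (rule T.diagonal_lattice)
  then show ?thesis unfolding image_translations by blast
qed

end

end

section \<open>The intersection property\<close>

lemma (in group) ord_involution:
  assumes "x \<in> carrier G" "x \<otimes> x = \<one>" "x \<noteq> \<one>"
  shows "ord x = 2"
proof -
  have "ord x dvd 2" using assms pow_eq_id[of x 2] by (simp add: numeral_2_eq_2)
  then have "ord x \<le> 2" "ord x \<noteq> 0" by (auto dest: dvd_imp_le intro: Nat.gr0I)
  moreover have "ord x \<noteq> 1" using assms ord_eq_1 by blast
  ultimately show ?thesis by linarith
qed

text \<open>The set \<open>\<chi> g {}\<close> records the generators of odd parity in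
  \<open>g\<close>, and it lies in both \<open>I\<close> and \<open>J\<close>. If one of them omits
  1 or is contained in \<open>{1}\<close>, this set already determines \<open>g\<close>. The
  remaining pairs are nested or covered by \<open>middle\<close>.\<close>

lemma (in group) intersection_property:
  assumes \<rho>: "\<And>i. i \<in> {0, 1, 2 :: nat} \<Longrightarrow> \<rho> i \<in> carrier G \<and> \<rho> i \<otimes> \<rho> i = \<one>"
    and comm: "\<rho> 2 \<otimes> \<rho> 0 = \<rho> 0 \<otimes> \<rho> 2"
    and \<chi>: "group_hom G perm_group \<chi>" "\<And>i. i \<in> {0, 1, 2} \<Longrightarrow> \<chi> (\<rho> i) = toggle i"
    and middle: "generate G {\<rho> 0, \<rho> 1} \<inter> generate G {\<rho> 1, \<rho> 2} \<subseteq> generate G {\<rho> 1}"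
    and IJ: "I \<subseteq> {0, 1, 2}" "J \<subseteq> {0, 1, 2}"
  shows "generate G (\<rho> ` I) \<inter> generate G (\<rho> ` J) = generate G (\<rho> ` (I \<inter> J))"
proof -
  interpret \<chi>: group_hom G perm_group \<chi> by (rule \<chi>)
  have sub: "\<rho> ` I \<subseteq> carrier G" if "I \<subseteq> {0, 1, 2}" for I using that \<rho> by auto
  have inv_gen: "inv (\<rho> i) = \<rho> i" if "i \<in> {0, 1, 2}" for i
    using \<rho>[OF that] by (auto intro: inv_equality)
  have pow2: "\<rho> i [^] (2::nat) = \<one>" if "i \<in> {0, 1, 2}" for i
    using \<rho>[OF that] by (simp add: numeral_2_eq_2)
  have bij: "bij (\<chi> g)" if "g \<in> carrier G" for g using \<chi>.hom_closed[OF that] by simp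
  have parity: "\<chi> g {} \<subseteq> I" if gen: "g \<in> generate G (\<rho> ` I)" and sub_I: "I \<subseteq> {0, 1, 2}" for g I
    using gen sub[OF sub_I]
  proof (induction rule: generate_left_induct)
    case (inv s)
    then obtain i where "i \<in> {0, 1, 2}" "s = \<rho> i" using sub_I by blast
    then have "inv s = s [^] (1::nat)" using inv_gen[of i] \<rho>[of i] by (simp del: One_nat_def)
    then show ?case by blast
  next
    case (mult s h)
    then obtain i where i: "i \<in> I" "s = \<rho> i" by auto
    then have i': "i \<in> {0, 1, 2}" using sub_I by blast
    have "\<chi> (s \<otimes> h) = \<chi> s \<otimes>\<^bsub>perm_group\<^esub> \<chi> h"
      using i(2) \<rho>[OF i'] mult(2) by (intro \<chi>.hom_mult) auto
    also have "\<dots> = toggle i \<circ> \<chi> h"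
      unfolding i(2) \<chi>(2)[OF i'] by (rule perm_group_simps(2)[OF bij_toggle bij[OF mult(2)]])
    finally have "\<chi> (s \<otimes> h) {} = toggle i (\<chi> h {})" by simp
    then show ?case using mult(3) i(1) by (auto simp: toggle_def split: if_splits)
  qed simp
  \<comment> \<open>The indices may coincide: \<open>i = k\<close> covers the subgroup of a single
    generator.\<close>
  have elementary: "g \<in> generate G (\<rho> ` \<chi> g {})"
    if g: "g \<in> generate G {\<rho> i, \<rho> k}" and ik: "i \<in> {0, 1, 2}" "k \<in> {0, 1, 2}"
      and c: "\<rho> k \<otimes> \<rho> i = \<rho> i \<otimes> \<rho> k" for g i k
  proof -
    have closed: "\<rho> i \<in> carrier G" "\<rho> k \<in> carrier G" using \<rho> ik by blast+
    have "(0::nat) < 2" by simp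
    from generate_commuting_pair[OF closed c pow2[OF ik(1)] this pow2[OF ik(2)] this g]
    obtain e f :: nat where ef: "e < 2" "f < 2" "g = \<rho> i [^] e \<otimes> \<rho> k [^] f" .
    have \<chi>_prod: "\<chi> (\<rho> i \<otimes> \<rho> k) = toggle i \<circ> toggle k"
      unfolding \<chi>.hom_mult[OF closed] \<chi>(2)[OF ik(1)] \<chi>(2)[OF ik(2)]
      by (rule perm_group_simps(2)[OF bij_toggle bij_toggle])
    have "e = 0 \<or> e = 1" "f = 0 \<or> f = 1" using ef by auto
    then consider "g = \<one>" | "g = \<rho> i" | "g = \<rho> k" | "g = \<rho> i \<otimes> \<rho> k" "i \<noteq> k"
      using ef(3) closed \<rho>[OF ik(1)] by (elim disjE) (cases "i = k", simp_all)+
    then show ?thesis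
    proof cases
      case 1
      then show ?thesis using generate.one by simp
    next
      case 2
      then have "\<chi> g {} = {i}" using \<chi>(2)[OF ik(1)] by (simp add: toggle_def)
      then show ?thesis using 2 generate.incl[of "\<rho> i" "{\<rho> i}" G] by simp
    next
      case 3
      then have "\<chi> g {} = {k}" using \<chi>(2)[OF ik(2)] by (simp add: toggle_def)
      then show ?thesis using 3 generate.incl[of "\<rho> k" "{\<rho> k}" G] by simp
    next
      case 4
      then have "\<chi> g {} = {i, k}" using \<chi>_prod by (simp add: toggle_def)
      then show ?thesis unfolding 4(1) by (simp add: generate.eng generate.incl)
    qed
  qed
  have easy: "g \<in> generate G (\<rho> ` (I \<inter> J))"
    if g: "g \<in> generate G (\<rho> ` I)" "g \<in> generate G (\<rho> ` J)" and IJ: "I \<subseteq> {0, 1, 2}" "J \<subseteq> {0, 1, 2}"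
      and el: "I \<subseteq> {0, 2} \<or> I \<subseteq> {1}" for g I J
  proof -
    have "\<chi> g {} \<subseteq> I \<inter> J" using parity g IJ by blast
    then have mono: "generate G (\<rho> ` \<chi> g {}) \<subseteq> generate G (\<rho> ` (I \<inter> J))"
      by (intro mono_generate image_mono)
    from el have "g \<in> generate G {\<rho> 0, \<rho> 2} \<or> g \<in> generate G {\<rho> 1, \<rho> 1}"
      using g(1) mono_generate[of "\<rho> ` I" "{\<rho> 0, \<rho> 2}"] mono_generate[of "\<rho> ` I" "{\<rho> 1, \<rho> 1}"]
      by blast
    then have "g \<in> generate G (\<rho> ` \<chi> g {})"
      using elementary[of g 0 2] elementary[of g 1 1] comm by auto
    then show ?thesis using mono by blast
  qed
  show ?thesis
  proof (intro subset_antisym Int_greatest subsetI)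
    fix g assume "g \<in> generate G (\<rho> ` I) \<inter> generate G (\<rho> ` J)"
    then have g: "g \<in> generate G (\<rho> ` I)" "g \<in> generate G (\<rho> ` J)" by auto
    have cases: "K \<subseteq> {0, 2} \<or> K \<subseteq> {1} \<or> K = {0, 1} \<or> K = {1, 2} \<or> K = {0, 1, 2}"
      if "K \<subseteq> {0, 1, 2}" for K :: "nat set" using that by (cases "0 \<in> K"; cases "1 \<in> K"; cases "2 \<in> K") auto
    consider "I \<subseteq> {0, 2} \<or> I \<subseteq> {1}" | "J \<subseteq> {0, 2} \<or> J \<subseteq> {1}" | "I \<subseteq> J" | "J \<subseteq> I"
      | "I = {0, 1}" "J = {1, 2}" | "J = {0, 1}" "I = {1, 2}"
      using cases[OF IJ(1)] cases[OF IJ(2)] IJ by blast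
    then show "g \<in> generate G (\<rho> ` (I \<inter> J))"
    proof cases
      case 1
      then show ?thesis using easy[OF g IJ] by blast
    next
      case 2
      then show ?thesis using easy[OF g(2,1) IJ(2,1)] by (simp add: Int_commute)
    next
      case 5
      then show ?thesis using middle g by auto
    next
      case 6
      then show ?thesis using middle g by auto
    qed (use g in \<open>simp_all add: Int_absorb1 Int_absorb2\<close>)
  qed (use mono_generate[of "\<rho> ` (I \<inter> J)" "\<rho> ` I"] mono_generate[of "\<rho> ` (I \<inter> J)" "\<rho> ` J"] in blast)+
qed

text \<open>In the dihedral image in which \<open>c\<close> dies, an element of \<open>\<langle>b, c\<rangle>\<close> becomes a power of \<open>b\<close>.\<close>

lemma (in string_group) middle_intersection:
  assumes h: "group_hom G D h" "h c = \<one>\<^bsub>D\<^esub>"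
    and faithful: "\<And>k. h (a \<otimes> b) [^]\<^bsub>D\<^esub> (k::nat) = \<one>\<^bsub>D\<^esub> \<Longrightarrow> (a \<otimes> b) [^] k = \<one>"
    and not: "\<And>k. h (a \<otimes> b) [^]\<^bsub>D\<^esub> (k::nat) \<noteq> h b"
    and pows: "(a \<otimes> b) [^] (M::nat) = \<one>" "M > 0" "(b \<otimes> c) [^] (N::nat) = \<one>" "N > 0"
    and g: "g \<in> generate G {a, b}" "g \<in> generate G {b, c}"
  shows "g \<in> generate G {b}"
proof -
  interpret h: group_hom G D h by (rule h)
  obtain i e :: nat where ie: "e < 2" "g = (a \<otimes> b) [^] i \<otimes> b [^] (e::nat)"
    by (rule generate_involution_pair[OF a_closed b_closed a_sq b_sq pows(1,2) g(1)])
  obtain j f :: nat where jf: "f < 2" "g = (b \<otimes> c) [^] j \<otimes> c [^] (f::nat)"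
    by (rule generate_involution_pair[OF b_closed c_closed b_sq c_sq pows(3,4) g(2)])
  have "h g = h (a \<otimes> b) [^]\<^bsub>D\<^esub> i \<otimes>\<^bsub>D\<^esub> h b [^]\<^bsub>D\<^esub> e" by (simp add: ie h.hom_nat_pow)
  moreover have "h g = h b [^]\<^bsub>D\<^esub> j" by (simp add: jf h.hom_nat_pow h(2))
  ultimately have eq: "h (a \<otimes> b) [^]\<^bsub>D\<^esub> i \<otimes>\<^bsub>D\<^esub> h b [^]\<^bsub>D\<^esub> e = h b [^]\<^bsub>D\<^esub> j" by simp
  have hb: "h b \<otimes>\<^bsub>D\<^esub> h b = \<one>\<^bsub>D\<^esub>" by (simp flip: h.hom_mult)
  have e: "h b [^]\<^bsub>D\<^esub> e \<otimes>\<^bsub>D\<^esub> h b [^]\<^bsub>D\<^esub> e = \<one>\<^bsub>D\<^esub>"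
    using hb ie(1) by (cases e rule: nat.exhaust) (auto simp: less_Suc_eq numeral_2_eq_2)
  have "h (a \<otimes> b) [^]\<^bsub>D\<^esub> i = (h (a \<otimes> b) [^]\<^bsub>D\<^esub> i \<otimes>\<^bsub>D\<^esub> h b [^]\<^bsub>D\<^esub> e) \<otimes>\<^bsub>D\<^esub> h b [^]\<^bsub>D\<^esub> e"
    using e by (simp add: h.H.m_assoc del: h.hom_mult)
  also have "\<dots> = h b [^]\<^bsub>D\<^esub> (j + e)" unfolding eq by (simp add: h.H.nat_pow_mult)
  finally have eq: "h (a \<otimes> b) [^]\<^bsub>D\<^esub> i = h b [^]\<^bsub>D\<^esub> (j + e)" .
  have "h b [^]\<^bsub>D\<^esub> m = \<one>\<^bsub>D\<^esub> \<or> h b [^]\<^bsub>D\<^esub> m = h b" for m :: nat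
    using hb by (induction m) auto
  \<comment> \<open>A power of the involution \<open>h b\<close> is trivial or \<open>h b\<close>
    itself, and no power of the rotation is \<open>h b\<close>.\<close>
  then have "h (a \<otimes> b) [^]\<^bsub>D\<^esub> i = \<one>\<^bsub>D\<^esub>" using not[of i] unfolding eq by metis
  then have "g = b [^] e" using faithful ie(2) by simp
  moreover have "e = 0 \<or> e = 1" using ie by auto
  ultimately show ?thesis by (auto intro: generate.one generate.incl)
qed

section \<open>The presented group\<close>

context
  fixes s t n l1 l2 :: nat
  assumes s_ge: "s \<ge> 2" and t_ge: "t \<ge> 2" and l1_pos: "l1 > 0" and l2_pos: "l2 > 0"
begin

abbreviation (input) "\<Gamma> \<equiv> presented_group {0, 1, 2} (relators s t n l1 l2)"
abbreviation (input) "\<sigma> \<equiv> presented_gen {0, 1, 2} (relators s t n l1 l2)"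

lemma relators_closed: "relators s t n l1 l2 \<subseteq> carrier (free_group {0, 1, 2})"
  using group.common_relators_closed[OF group_free_group, of "free_gen {0, 1, 2}"]
  by (auto simp: relators_def Let_def)

lemma group_presented: "group \<Gamma>"
  by (rule group_presented_group[OF relators_closed])

lemma presented_relators:
  "\<And>i. i \<in> {0, 1, 2} \<Longrightarrow> \<sigma> i \<in> carrier \<Gamma>"
  "common_relators \<Gamma> \<sigma> s t l1 l2 \<subseteq> {\<one>\<^bsub>\<Gamma>\<^esub>}"
  "extra_relator \<Gamma> \<sigma> s t n = \<one>\<^bsub>\<Gamma>\<^esub>"
proof -
  let ?F = "free_group {0, 1, 2 :: nat}"
  obtain h where h: "h \<in> hom ?F \<Gamma>" "\<And>x. h (free_gen {0, 1, 2} x) = \<sigma> x"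
    "\<And>r. r \<in> relators s t n l1 l2 \<Longrightarrow> h r = \<one>\<^bsub>\<Gamma>\<^esub>"
    using presented_group_proj[OF relators_closed] by metis
  interpret h: group_hom ?F \<Gamma> h
    by (intro group_hom.intro group_free_group group_presented group_hom_axioms.intro h(1))
  have closed: "free_gen {0, 1, 2} i \<in> carrier ?F" if "i \<in> {0, 1, 2}" for i :: nat using that by simp
  show "\<sigma> i \<in> carrier \<Gamma>" if "i \<in> {0, 1, 2}" for i
    using h.hom_closed[OF closed[OF that]] by (simp only: h(2))
  have comp: "h \<circ> free_gen {0, 1, 2} = \<sigma>" by (rule ext) (simp only: o_apply h(2))
  show "common_relators \<Gamma> \<sigma> s t l1 l2 \<subseteq> {\<one>\<^bsub>\<Gamma>\<^esub>}"
  proof -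
    have "common_relators \<Gamma> \<sigma> s t l1 l2 = h ` common_relators ?F (free_gen {0, 1, 2}) s t l1 l2"
      unfolding comp[symmetric] by (rule h.hom_common_relators[symmetric]) (rule closed)
    then show ?thesis using h(3) by (auto simp only: relators_def Let_def)
  qed
  have "extra_relator \<Gamma> \<sigma> s t n = h (extra_relator ?F (free_gen {0, 1, 2}) s t n)"
    unfolding comp[symmetric] by (rule h.hom_extra_relator[symmetric]) (rule closed)
  then show "extra_relator \<Gamma> \<sigma> s t n = \<one>\<^bsub>\<Gamma>\<^esub>"
    using h(3) by (auto simp only: relators_def Let_def)
qed

lemma presented_relators_group: "relators_group \<Gamma> (\<sigma> 0) (\<sigma> 1) (\<sigma> 2) s t l1 l2"
proof -
  interpret group \<Gamma> by (rule group_presented)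
  note rel = trivial_common_relators[OF presented_relators(1,2)]
  interpret string_involutions \<Gamma> "\<sigma> 0" "\<sigma> 1" "\<sigma> 2" by (rule rel(1))
  show ?thesis
  proof
    show "generate \<Gamma> {\<sigma> 0, \<sigma> 1, \<sigma> 2} = carrier \<Gamma>"
      using generate_presented_gen[OF relators_closed] by simp
  qed (simp_all only: s_ge t_ge l1_pos l2_pos rel)
qed

section \<open>Explicit quotients of the presented group\<close>

lemma dihedral_hom:
  obtains h :: "nat word set set \<Rightarrow> complex \<Rightarrow> complex" where
    "group_hom \<Gamma> perm_group h" "h (\<sigma> 2) = \<one>\<^bsub>perm_group\<^esub>"
    "\<And>k. h (\<sigma> 0 \<otimes>\<^bsub>\<Gamma>\<^esub> \<sigma> 1) [^]\<^bsub>perm_group\<^esub> (k::nat) = \<one>\<^bsub>perm_group\<^esub> \<longleftrightarrow> 2 ^ s * l1 dvd k"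
    "\<And>k. h (\<sigma> 0 \<otimes>\<^bsub>\<Gamma>\<^esub> \<sigma> 1) [^]\<^bsub>perm_group\<^esub> (k::nat) \<noteq> h (\<sigma> 1)"
proof -
  have "2 ^ s * l1 > 0" using l1_pos by simp
  then obtain \<alpha> \<beta> :: "complex \<Rightarrow> complex" where m:
    "\<alpha> \<in> carrier perm_group" "\<beta> \<in> carrier perm_group"
    "\<alpha> \<otimes>\<^bsub>perm_group\<^esub> \<alpha> = \<one>\<^bsub>perm_group\<^esub>" "\<beta> \<otimes>\<^bsub>perm_group\<^esub> \<beta> = \<one>\<^bsub>perm_group\<^esub>"
    "\<And>k::nat. (\<alpha> \<otimes>\<^bsub>perm_group\<^esub> \<beta>) [^]\<^bsub>perm_group\<^esub> k = \<one>\<^bsub>perm_group\<^esub> \<longleftrightarrow> 2 ^ s * l1 dvd k"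
    "\<And>k::nat. (\<alpha> \<otimes>\<^bsub>perm_group\<^esub> \<beta>) [^]\<^bsub>perm_group\<^esub> k \<noteq> \<beta>"
    by (rule dihedral_model) blast
  have "perm.satisfies_relators s t n l1 l2 \<alpha> \<beta> \<one>\<^bsub>perm_group\<^esub>"
    by (rule perm.dihedral_satisfies_relators[OF m(1-4) _ t_ge]) (simp only: m(5) dvd_refl)
  from presented_relators_hom[OF perm.group_axioms this]
  obtain h where h: "group_hom \<Gamma> perm_group h" "h (\<sigma> 0) = \<alpha>" "h (\<sigma> 1) = \<beta>"
    "h (\<sigma> 2) = \<one>\<^bsub>perm_group\<^esub>" .
  have "h (\<sigma> 0 \<otimes>\<^bsub>\<Gamma>\<^esub> \<sigma> 1) = \<alpha> \<otimes>\<^bsub>perm_group\<^esub> \<beta>"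
    using group_hom.hom_mult[OF h(1) presented_relators(1) presented_relators(1), of 0 1] h by simp
  with h m that show thesis by metis
qed

lemma dual_dihedral_hom:
  obtains h :: "nat word set set \<Rightarrow> complex \<Rightarrow> complex" where
    "group_hom \<Gamma> perm_group h"
    "\<And>k. h (\<sigma> 1 \<otimes>\<^bsub>\<Gamma>\<^esub> \<sigma> 2) [^]\<^bsub>perm_group\<^esub> (k::nat) = \<one>\<^bsub>perm_group\<^esub> \<longleftrightarrow> 2 ^ t * l2 dvd k"
proof -
  have "2 ^ t * l2 > 0" using l2_pos by simp
  then obtain \<beta> \<gamma> :: "complex \<Rightarrow> complex" where m:
    "\<beta> \<in> carrier perm_group" "\<gamma> \<in> carrier perm_group"
    "\<beta> \<otimes>\<^bsub>perm_group\<^esub> \<beta> = \<one>\<^bsub>perm_group\<^esub>" "\<gamma> \<otimes>\<^bsub>perm_group\<^esub> \<gamma> = \<one>\<^bsub>perm_group\<^esub>"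
    "\<And>k::nat. (\<beta> \<otimes>\<^bsub>perm_group\<^esub> \<gamma>) [^]\<^bsub>perm_group\<^esub> k = \<one>\<^bsub>perm_group\<^esub> \<longleftrightarrow> 2 ^ t * l2 dvd k"
    "\<And>k::nat. (\<beta> \<otimes>\<^bsub>perm_group\<^esub> \<gamma>) [^]\<^bsub>perm_group\<^esub> k \<noteq> \<gamma>"
    by (rule dihedral_model) blast
  have "perm.satisfies_relators s t n l1 l2 \<one>\<^bsub>perm_group\<^esub> \<beta> \<gamma>"
    by (rule perm.dual_dihedral_satisfies_relators[OF m(1-4) _ s_ge]) (simp only: m(5) dvd_refl)
  from presented_relators_hom[OF perm.group_axioms this]
  obtain h where h: "group_hom \<Gamma> perm_group h" "h (\<sigma> 0) = \<one>\<^bsub>perm_group\<^esub>" "h (\<sigma> 1) = \<beta>"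
    "h (\<sigma> 2) = \<gamma>" .
  have "h (\<sigma> 1 \<otimes>\<^bsub>\<Gamma>\<^esub> \<sigma> 2) = \<beta> \<otimes>\<^bsub>perm_group\<^esub> \<gamma>"
    using group_hom.hom_mult[OF h(1) presented_relators(1) presented_relators(1), of 1 2] h by simp
  with h m that show thesis by metis
qed

lemma point_group_hom:
  obtains h :: "nat word set set \<Rightarrow> complex \<Rightarrow> complex" where
    "group_hom \<Gamma> perm_group h"
    "h (\<sigma> 2) = h (\<sigma> 1) \<otimes>\<^bsub>perm_group\<^esub> h (\<sigma> 0) \<otimes>\<^bsub>perm_group\<^esub> h (\<sigma> 1)"
    "\<And>k. h (\<sigma> 0 \<otimes>\<^bsub>\<Gamma>\<^esub> \<sigma> 1) [^]\<^bsub>perm_group\<^esub> (k::nat) = \<one>\<^bsub>perm_group\<^esub> \<longleftrightarrow> 4 dvd k"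
    "\<And>k. h (\<sigma> 0 \<otimes>\<^bsub>\<Gamma>\<^esub> \<sigma> 1) [^]\<^bsub>perm_group\<^esub> (k::nat) \<noteq> h (\<sigma> 1)"
proof -
  have "(4::nat) > 0" by simp
  then obtain \<alpha> \<beta> :: "complex \<Rightarrow> complex" where m:
    "\<alpha> \<in> carrier perm_group" "\<beta> \<in> carrier perm_group"
    "\<alpha> \<otimes>\<^bsub>perm_group\<^esub> \<alpha> = \<one>\<^bsub>perm_group\<^esub>" "\<beta> \<otimes>\<^bsub>perm_group\<^esub> \<beta> = \<one>\<^bsub>perm_group\<^esub>"
    "\<And>k::nat. (\<alpha> \<otimes>\<^bsub>perm_group\<^esub> \<beta>) [^]\<^bsub>perm_group\<^esub> k = \<one>\<^bsub>perm_group\<^esub> \<longleftrightarrow> 4 dvd k"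
    "\<And>k::nat. (\<alpha> \<otimes>\<^bsub>perm_group\<^esub> \<beta>) [^]\<^bsub>perm_group\<^esub> k \<noteq> \<beta>"
    by (rule dihedral_model) blast
  have "perm.satisfies_relators s t n l1 l2 \<alpha> \<beta> (\<beta> \<otimes>\<^bsub>perm_group\<^esub> \<alpha> \<otimes>\<^bsub>perm_group\<^esub> \<beta>)"
    by (rule perm.point_group_satisfies_relators[OF m(1-4) _ s_ge t_ge]) (simp only: m(5) dvd_refl)
  from presented_relators_hom[OF perm.group_axioms this]
  obtain h where h: "group_hom \<Gamma> perm_group h" "h (\<sigma> 0) = \<alpha>" "h (\<sigma> 1) = \<beta>"
    "h (\<sigma> 2) = \<beta> \<otimes>\<^bsub>perm_group\<^esub> \<alpha> \<otimes>\<^bsub>perm_group\<^esub> \<beta>" .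
  have "h (\<sigma> 0 \<otimes>\<^bsub>\<Gamma>\<^esub> \<sigma> 1) = \<alpha> \<otimes>\<^bsub>perm_group\<^esub> \<beta>"
    using group_hom.hom_mult[OF h(1) presented_relators(1) presented_relators(1), of 0 1] h by simp
  with h m that show thesis by metis
qed

lemma toggle_hom:
  obtains \<chi> where "group_hom \<Gamma> perm_group \<chi>" "\<And>i. i \<in> {0, 1, 2} \<Longrightarrow> \<chi> (\<sigma> i) = toggle i"
proof -
  have "perm.satisfies_relators s t n l1 l2 (toggle 0) (toggle 1) (toggle 2)"
    by (rule perm.commuting_satisfies_relators)
      (simp_all only: perm_group_simps bij_toggle toggle_simps s_ge t_ge)
  from presented_relators_hom[OF perm.group_axioms this]
  obtain \<chi> where "group_hom \<Gamma> perm_group \<chi>" "\<chi> (\<sigma> 0) = toggle 0" "\<chi> (\<sigma> 1) = toggle 1"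
    "\<chi> (\<sigma> 2) = toggle 2" .
  then show thesis using that[of \<chi>] by auto
qed

text \<open>The relations of order 4 in the model put \<open>p\<close> and \<open>q\<close> into the
  kernel, as \<open>order_formula\<close> requires of \<open>w\<close>.\<close>

lemma torus_hom:
  fixes \<alpha> \<beta> \<gamma> :: "complex \<times> complex \<Rightarrow> complex \<times> complex"
  assumes "square_tessellation perm_group \<alpha> \<beta> \<gamma>"
    and "odd (n - s - t) \<Longrightarrow> (\<beta> \<otimes>\<^bsub>perm_group\<^esub> \<alpha> \<otimes>\<^bsub>perm_group\<^esub> \<beta> \<otimes>\<^bsub>perm_group\<^esub> \<gamma>)
      [^]\<^bsub>perm_group\<^esub> ((2::nat) ^ Suc ((n - s - t - 1) div 2)) = \<one>\<^bsub>perm_group\<^esub>"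
    and "even (n - s - t) \<Longrightarrow> (\<alpha> \<otimes>\<^bsub>perm_group\<^esub> \<beta> \<otimes>\<^bsub>perm_group\<^esub> \<gamma> \<otimes>\<^bsub>perm_group\<^esub> \<beta> \<otimes>\<^bsub>perm_group\<^esub>
      (\<beta> \<otimes>\<^bsub>perm_group\<^esub> \<alpha> \<otimes>\<^bsub>perm_group\<^esub> \<beta> \<otimes>\<^bsub>perm_group\<^esub> \<gamma>))
      [^]\<^bsub>perm_group\<^esub> ((2::nat) ^ Suc ((n - s - t - 2) div 2)) = \<one>\<^bsub>perm_group\<^esub>"
  obtains w where "group_hom \<Gamma> perm_group w" "w (\<sigma> 0) = \<alpha>" "w (\<sigma> 1) = \<beta>" "w (\<sigma> 2) = \<gamma>"
    "w ((\<sigma> 0 \<otimes>\<^bsub>\<Gamma>\<^esub> \<sigma> 1) [^]\<^bsub>\<Gamma>\<^esub> (4::nat)) = \<one>\<^bsub>perm_group\<^esub>"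
    "w ((\<sigma> 1 \<otimes>\<^bsub>\<Gamma>\<^esub> \<sigma> 2) [^]\<^bsub>\<Gamma>\<^esub> (4::nat)) = \<one>\<^bsub>perm_group\<^esub>"
proof -
  interpret M: square_tessellation perm_group \<alpha> \<beta> \<gamma> by fact
  have "perm.satisfies_relators s t n l1 l2 \<alpha> \<beta> \<gamma>"
    by (rule M.satisfies_relatorsI_tessellation[OF s_ge t_ge]) (fact assms)+
  from presented_relators_hom[OF perm.group_axioms this]
  obtain w where w: "group_hom \<Gamma> perm_group w" "w (\<sigma> 0) = \<alpha>" "w (\<sigma> 1) = \<beta>" "w (\<sigma> 2) = \<gamma>" .
  interpret w: group_hom \<Gamma> perm_group w by fact
  have closed: "\<sigma> 0 \<in> carrier \<Gamma>" "\<sigma> 1 \<in> carrier \<Gamma>" "\<sigma> 2 \<in> carrier \<Gamma>"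
    using presented_relators(1) by blast+
  have "w ((\<sigma> 0 \<otimes>\<^bsub>\<Gamma>\<^esub> \<sigma> 1) [^]\<^bsub>\<Gamma>\<^esub> (4::nat)) = \<one>\<^bsub>perm_group\<^esub>"
    "w ((\<sigma> 1 \<otimes>\<^bsub>\<Gamma>\<^esub> \<sigma> 2) [^]\<^bsub>\<Gamma>\<^esub> (4::nat)) = \<one>\<^bsub>perm_group\<^esub>"
    by (simp_all only: w.hom_nat_pow w.hom_mult closed w.G.m_closed w M.ab4 M.bc4)
  with w that show thesis by blast
qed

section \<open>Order, type and the string C-group property\<close>

lemma presented_order:
  assumes n: "n \<ge> s + t + 1"
  shows "order \<Gamma> = 2 ^ n * l1 * l2"
proof -
  interpret relators_group \<Gamma> "\<sigma> 0" "\<sigma> 1" "\<sigma> 2" s t l1 l2 by (rule presented_relators_group)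
  obtain h1 :: "nat word set set \<Rightarrow> complex \<Rightarrow> complex" where h1: "group_hom \<Gamma> perm_group h1"
    "h1 (\<sigma> 2) = \<one>\<^bsub>perm_group\<^esub>"
    "\<And>k. h1 (\<sigma> 0 \<otimes>\<^bsub>\<Gamma>\<^esub> \<sigma> 1) [^]\<^bsub>perm_group\<^esub> (k::nat) = \<one>\<^bsub>perm_group\<^esub> \<longleftrightarrow> 2 ^ s * l1 dvd k"
    by (rule dihedral_hom) blast
  obtain h2 :: "nat word set set \<Rightarrow> complex \<Rightarrow> complex" where h2: "group_hom \<Gamma> perm_group h2"
    "\<And>k. h2 (\<sigma> 1 \<otimes>\<^bsub>\<Gamma>\<^esub> \<sigma> 2) [^]\<^bsub>perm_group\<^esub> (k::nat) = \<one>\<^bsub>perm_group\<^esub> \<longleftrightarrow> 2 ^ t * l2 dvd k"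
    by (rule dual_dihedral_hom) blast
  obtain h3 :: "nat word set set \<Rightarrow> complex \<Rightarrow> complex" where h3: "group_hom \<Gamma> perm_group h3"
    "h3 (\<sigma> 2) = h3 (\<sigma> 1) \<otimes>\<^bsub>perm_group\<^esub> h3 (\<sigma> 0) \<otimes>\<^bsub>perm_group\<^esub> h3 (\<sigma> 1)"
    "\<And>k. h3 (\<sigma> 0 \<otimes>\<^bsub>\<Gamma>\<^esub> \<sigma> 1) [^]\<^bsub>perm_group\<^esub> (k::nat) = \<one>\<^bsub>perm_group\<^esub> \<longleftrightarrow> 4 dvd k"
    "\<And>k. h3 (\<sigma> 0 \<otimes>\<^bsub>\<Gamma>\<^esub> \<sigma> 1) [^]\<^bsub>perm_group\<^esub> (k::nat) \<noteq> h3 (\<sigma> 1)"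
    by (rule point_group_hom) blast
  let ?t1 = "\<sigma> 0 \<otimes>\<^bsub>\<Gamma>\<^esub> \<sigma> 1 \<otimes>\<^bsub>\<Gamma>\<^esub> \<sigma> 2 \<otimes>\<^bsub>\<Gamma>\<^esub> \<sigma> 1"
    and ?t2 = "\<sigma> 1 \<otimes>\<^bsub>\<Gamma>\<^esub> \<sigma> 0 \<otimes>\<^bsub>\<Gamma>\<^esub> \<sigma> 1 \<otimes>\<^bsub>\<Gamma>\<^esub> \<sigma> 2"
  have h3_pow: "h3 (\<sigma> 0 \<otimes>\<^bsub>\<Gamma>\<^esub> \<sigma> 1) [^]\<^bsub>perm_group\<^esub> (4::nat) = \<one>\<^bsub>perm_group\<^esub>"
    by (simp only: h3(3) dvd_refl)
  note h3_trivial = point_group_kernel[OF h3(1,2) h3_pow]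
  show ?thesis
  proof (cases "odd (n - s - t)")
    case True
    define k where "k = (n - s - t - 1) div 2"
    have n_eq: "n = s + t + (2 * k + 1)"
      using True n unfolding k_def by (elim oddE) simp
    \<comment> \<open>The extra relator gives the square of \<open>?t2\<close> the exponent
      \<open>2 ^ k\<close>, hence \<open>?t2\<close> the exponent \<open>?M\<close>.\<close>
    let ?M = "2 ^ Suc k :: nat"
    have M: "?M > 0" by simp
    obtain \<alpha> \<beta> \<gamma> :: "complex \<times> complex \<Rightarrow> complex \<times> complex" and \<tau>1 \<tau>2 where m: "square_tessellation perm_group \<alpha> \<beta> \<gamma>"
      "\<tau>1 = \<alpha> \<otimes>\<^bsub>perm_group\<^esub> \<beta> \<otimes>\<^bsub>perm_group\<^esub> \<gamma> \<otimes>\<^bsub>perm_group\<^esub> \<beta>"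
      "\<tau>2 = \<beta> \<otimes>\<^bsub>perm_group\<^esub> \<alpha> \<otimes>\<^bsub>perm_group\<^esub> \<beta> \<otimes>\<^bsub>perm_group\<^esub> \<gamma>"
      "\<tau>2 [^]\<^bsub>perm_group\<^esub> ?M = \<one>\<^bsub>perm_group\<^esub>"
      "inj_on (\<lambda>(i, j). \<tau>1 [^]\<^bsub>perm_group\<^esub> i \<otimes>\<^bsub>perm_group\<^esub> \<tau>2 [^]\<^bsub>perm_group\<^esub> j) ({..<?M} \<times> {..<?M})"
      by (rule rectangular_torus_model[OF M])
    obtain w where w: "group_hom \<Gamma> perm_group w" "w (\<sigma> 0) = \<alpha>" "w (\<sigma> 1) = \<beta>" "w (\<sigma> 2) = \<gamma>"
      "w ((\<sigma> 0 \<otimes>\<^bsub>\<Gamma>\<^esub> \<sigma> 1) [^]\<^bsub>\<Gamma>\<^esub> (4::nat)) = \<one>\<^bsub>perm_group\<^esub>"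
      "w ((\<sigma> 1 \<otimes>\<^bsub>\<Gamma>\<^esub> \<sigma> 2) [^]\<^bsub>\<Gamma>\<^esub> (4::nat)) = \<one>\<^bsub>perm_group\<^esub>"
    proof (rule torus_hom[OF m(1)])
      show "(\<beta> \<otimes>\<^bsub>perm_group\<^esub> \<alpha> \<otimes>\<^bsub>perm_group\<^esub> \<beta> \<otimes>\<^bsub>perm_group\<^esub> \<gamma>)
        [^]\<^bsub>perm_group\<^esub> ((2::nat) ^ Suc ((n - s - t - 1) div 2)) = \<one>\<^bsub>perm_group\<^esub>"
        using m(4) unfolding m(3) k_def .
    qed (use True in blast)+
    interpret w: group_hom \<Gamma> perm_group w by (rule w(1))
    have w_t: "w ?t1 = \<tau>1" "w ?t2 = \<tau>2"
      by (simp_all only: w.hom_mult a_closed b_closed c_closed m_closed w(2-4) m(2,3))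
    have "(?t2 [^]\<^bsub>\<Gamma>\<^esub> (2::nat)) [^]\<^bsub>\<Gamma>\<^esub> ((2::nat) ^ k) = \<one>\<^bsub>\<Gamma>\<^esub>"
      using presented_relators(3) True unfolding extra_relator_def k_def[symmetric]
      by (simp only: commutator_half_turn if_True simp_thms)
    then have t2: "?t2 [^]\<^bsub>\<Gamma>\<^esub> ?M = \<one>\<^bsub>\<Gamma>\<^esub>"
      by (simp only: nat_pow_pow a_closed b_closed c_closed m_closed power_Suc)
    have "order \<Gamma> = 2 ^ (s - 2) * l1 * (2 ^ (t - 2) * l2) * ?M * ?M * 8"
    proof (rule order_formula[OF _ _ h1 h2 h3(1) h3_trivial(1,2,3) h3(3,4) w(1,5,6)])
      show "inj_on (\<lambda>(i, j). w ?t1 [^]\<^bsub>perm_group\<^esub> i \<otimes>\<^bsub>perm_group\<^esub> w ?t2 [^]\<^bsub>perm_group\<^esub> j)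
        ({..<?M} \<times> {..<?M})"
        unfolding w_t by (rule m(5))
      show "\<exists>k<?M. \<exists>l<?M. g = h ?t1 [^]\<^bsub>T\<^esub> k \<otimes>\<^bsub>T\<^esub> h ?t2 [^]\<^bsub>T\<^esub> l"
        if "group_hom \<Gamma> T h" "square_tessellation_group T (h (\<sigma> 0)) (h (\<sigma> 1)) (h (\<sigma> 2))"
          "g \<in> generate T {h ?t1, h ?t2}" for T :: "nat word set set set monoid" and h g
        by (rule rectangular_lattice_image[OF that t2 M])
    qed (rule m_closed a_closed b_closed c_closed)+
    \<comment> \<open>The factor 8 and the \<open>2 ^ (2 * k + 2)\<close> translations make 16 times
      \<open>2 ^ (2 * k + 1)\<close>; the 16 restores the full exponents of the two
      rotations.\<close>
    also have "\<dots> = (4 * (2 ^ (s - 2) * l1)) * (4 * (2 ^ (t - 2) * l2)) * 2 ^ (2 * k + 1)"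
      by (simp add: power_add power_mult power2_eq_square power_mult_distrib[symmetric])
    also have "\<dots> = 2 ^ n * l1 * l2" unfolding four_P four_Q n_eq by (simp add: power_add)
    finally show ?thesis .
  next
    case False
    define k where "k = (n - s - t - 2) div 2"
    \<comment> \<open>The bound on \<open>n\<close> excludes the difference 0, so an even difference
      is at least 2 and subtracting 2 is not truncated.\<close>
    have "x = 2 * ((x - 2) div 2) + 2" if "even x" "x \<noteq> 0" for x :: nat
      using that by presburger
    from this[of "n - s - t"] have "n - s - t = 2 * k + 2"
      unfolding k_def using False n by linarith
    then have n_eq: "n = s + t + (2 * k + 2)" using n by simp
    \<comment> \<open>In the tessellation quotient the product of the two translations has exponent
      \<open>?M\<close>, which leaves at most \<open>2 * ?M * ?M\<close> translations.\<close>
    let ?M = "2 ^ Suc k :: nat"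
    have M: "?M > 0" by simp
    obtain \<alpha> \<beta> \<gamma> :: "complex \<times> complex \<Rightarrow> complex \<times> complex" and \<tau>1 \<tau>2 where m: "square_tessellation perm_group \<alpha> \<beta> \<gamma>"
      "\<tau>1 = \<alpha> \<otimes>\<^bsub>perm_group\<^esub> \<beta> \<otimes>\<^bsub>perm_group\<^esub> \<gamma> \<otimes>\<^bsub>perm_group\<^esub> \<beta>"
      "\<tau>2 = \<beta> \<otimes>\<^bsub>perm_group\<^esub> \<alpha> \<otimes>\<^bsub>perm_group\<^esub> \<beta> \<otimes>\<^bsub>perm_group\<^esub> \<gamma>"
      "(\<tau>1 \<otimes>\<^bsub>perm_group\<^esub> \<tau>2) [^]\<^bsub>perm_group\<^esub> ?M = \<one>\<^bsub>perm_group\<^esub>"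
      "inj_on (\<lambda>(i, j). \<tau>1 [^]\<^bsub>perm_group\<^esub> i \<otimes>\<^bsub>perm_group\<^esub> (\<tau>1 \<otimes>\<^bsub>perm_group\<^esub> \<tau>2) [^]\<^bsub>perm_group\<^esub> j)
        ({..<2 * ?M} \<times> {..<?M})"
      by (rule diagonal_torus_model[OF M])
    obtain w where w: "group_hom \<Gamma> perm_group w" "w (\<sigma> 0) = \<alpha>" "w (\<sigma> 1) = \<beta>" "w (\<sigma> 2) = \<gamma>"
      "w ((\<sigma> 0 \<otimes>\<^bsub>\<Gamma>\<^esub> \<sigma> 1) [^]\<^bsub>\<Gamma>\<^esub> (4::nat)) = \<one>\<^bsub>perm_group\<^esub>"
      "w ((\<sigma> 1 \<otimes>\<^bsub>\<Gamma>\<^esub> \<sigma> 2) [^]\<^bsub>\<Gamma>\<^esub> (4::nat)) = \<one>\<^bsub>perm_group\<^esub>"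
    proof (rule torus_hom[OF m(1)])
      show "(\<alpha> \<otimes>\<^bsub>perm_group\<^esub> \<beta> \<otimes>\<^bsub>perm_group\<^esub> \<gamma> \<otimes>\<^bsub>perm_group\<^esub> \<beta> \<otimes>\<^bsub>perm_group\<^esub>
          (\<beta> \<otimes>\<^bsub>perm_group\<^esub> \<alpha> \<otimes>\<^bsub>perm_group\<^esub> \<beta> \<otimes>\<^bsub>perm_group\<^esub> \<gamma>))
        [^]\<^bsub>perm_group\<^esub> ((2::nat) ^ Suc ((n - s - t - 2) div 2)) = \<one>\<^bsub>perm_group\<^esub>"
        using m(4) unfolding m(2,3) k_def .
    qed (use False in blast)+
    interpret w: group_hom \<Gamma> perm_group w by (rule w(1))
    have w_t: "w ?t1 = \<tau>1" "w (?t1 \<otimes>\<^bsub>\<Gamma>\<^esub> ?t2) = \<tau>1 \<otimes>\<^bsub>perm_group\<^esub> \<tau>2"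
      by (simp_all only: w.hom_mult a_closed b_closed c_closed m_closed w(2-4) m(2,3))
    let ?c = "commutator \<Gamma> ((\<sigma> 0 \<otimes>\<^bsub>\<Gamma>\<^esub> \<sigma> 1) [^]\<^bsub>\<Gamma>\<^esub> (2::nat)) ((\<sigma> 1 \<otimes>\<^bsub>\<Gamma>\<^esub> \<sigma> 2) [^]\<^bsub>\<Gamma>\<^esub> (2::nat))"
    have c: "?c [^]\<^bsub>\<Gamma>\<^esub> ((2::nat) ^ k) = \<one>\<^bsub>\<Gamma>\<^esub>"
      using presented_relators(3) False unfolding extra_relator_def k_def[symmetric]
      by (simp only: if_False simp_thms)
    have "order \<Gamma> = 2 ^ (s - 2) * l1 * (2 ^ (t - 2) * l2) * (2 * ?M) * ?M * 8"
    proof (rule order_formula[OF _ _ h1 h2 h3(1) h3_trivial(1,2,4) h3(3,4) w(1,5,6)])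
      show "inj_on (\<lambda>(i, j). w ?t1 [^]\<^bsub>perm_group\<^esub> i \<otimes>\<^bsub>perm_group\<^esub>
          w (?t1 \<otimes>\<^bsub>\<Gamma>\<^esub> ?t2) [^]\<^bsub>perm_group\<^esub> j) ({..<2 * ?M} \<times> {..<?M})"
        unfolding w_t by (rule m(5))
      show "\<exists>k<2 * ?M. \<exists>l<?M. g = h ?t1 [^]\<^bsub>T\<^esub> k \<otimes>\<^bsub>T\<^esub> h (?t1 \<otimes>\<^bsub>\<Gamma>\<^esub> ?t2) [^]\<^bsub>T\<^esub> l"
        if "group_hom \<Gamma> T h" "square_tessellation_group T (h (\<sigma> 0)) (h (\<sigma> 1)) (h (\<sigma> 2))"
          "g \<in> generate T {h ?t1, h ?t2}" for T :: "nat word set set set monoid" and h g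
        unfolding power_Suc by (rule diagonal_lattice_image[OF that c]) simp
    qed (rule m_closed a_closed b_closed c_closed)+
    also have "\<dots> = (4 * (2 ^ (s - 2) * l1)) * (4 * (2 ^ (t - 2) * l2)) * 2 ^ (2 * k + 2)"
      by (simp add: power_add power_mult power2_eq_square power_mult_distrib[symmetric])
    also have "\<dots> = 2 ^ n * l1 * l2" unfolding four_P four_Q n_eq by (simp add: power_add)
    finally show ?thesis .
  qed
qed

text \<open>The relators make each order a divisor of the claimed value, and a dihedral quotient
  makes it a multiple.\<close>

lemma presented_ords:
  "group.ord \<Gamma> (\<sigma> 0 \<otimes>\<^bsub>\<Gamma>\<^esub> \<sigma> 1) = 2 ^ s * l1" "group.ord \<Gamma> (\<sigma> 1 \<otimes>\<^bsub>\<Gamma>\<^esub> \<sigma> 2) = 2 ^ t * l2"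
proof -
  interpret relators_group \<Gamma> "\<sigma> 0" "\<sigma> 1" "\<sigma> 2" s t l1 l2 by (rule presented_relators_group)
  have ord: "ord x = M" if x: "x \<in> carrier \<Gamma>" "x [^]\<^bsub>\<Gamma>\<^esub> M = \<one>\<^bsub>\<Gamma>\<^esub>" and h: "group_hom \<Gamma> H h"
    and dvd: "\<And>k. h x [^]\<^bsub>H\<^esub> (k::nat) = \<one>\<^bsub>H\<^esub> \<Longrightarrow> M dvd k"
    for x M h and H :: "(complex \<Rightarrow> complex) monoid"
  proof (rule dvd_antisym)
    interpret h: group_hom \<Gamma> H h by (rule h)
    show "ord x dvd M" using x pow_eq_id by blast
    have "h x [^]\<^bsub>H\<^esub> ord x = \<one>\<^bsub>H\<^esub>"
      using x(1) by (metis h.hom_nat_pow h.hom_one pow_ord_eq_1)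
    then show "M dvd ord x" by (rule dvd)
  qed
  obtain h1 :: "nat word set set \<Rightarrow> complex \<Rightarrow> complex" where h1: "group_hom \<Gamma> perm_group h1"
    "\<And>k. h1 (\<sigma> 0 \<otimes>\<^bsub>\<Gamma>\<^esub> \<sigma> 1) [^]\<^bsub>perm_group\<^esub> (k::nat) = \<one>\<^bsub>perm_group\<^esub> \<longleftrightarrow> 2 ^ s * l1 dvd k"
    by (rule dihedral_hom) blast
  show "ord (\<sigma> 0 \<otimes>\<^bsub>\<Gamma>\<^esub> \<sigma> 1) = 2 ^ s * l1"
    by (rule ord[OF m_closed[OF a_closed b_closed] ab_pow h1(1) iffD1[OF h1(2)]])
  obtain h2 :: "nat word set set \<Rightarrow> complex \<Rightarrow> complex" where h2: "group_hom \<Gamma> perm_group h2"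
    "\<And>k. h2 (\<sigma> 1 \<otimes>\<^bsub>\<Gamma>\<^esub> \<sigma> 2) [^]\<^bsub>perm_group\<^esub> (k::nat) = \<one>\<^bsub>perm_group\<^esub> \<longleftrightarrow> 2 ^ t * l2 dvd k"
    by (rule dual_dihedral_hom) blast
  show "ord (\<sigma> 1 \<otimes>\<^bsub>\<Gamma>\<^esub> \<sigma> 2) = 2 ^ t * l2"
    by (rule ord[OF m_closed[OF b_closed c_closed] bc_pow h2(1) iffD1[OF h2(2)]])
qed

lemma presented_string_C_group: "string_C_group_rank3 \<Gamma> \<sigma>"
proof -
  interpret relators_group \<Gamma> "\<sigma> 0" "\<sigma> 1" "\<sigma> 2" s t l1 l2 by (rule presented_relators_group)
  obtain \<chi> where \<chi>: "group_hom \<Gamma> perm_group \<chi>" "\<And>i. i \<in> {0, 1, 2} \<Longrightarrow> \<chi> (\<sigma> i) = toggle i"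
    by (rule toggle_hom) blast
  interpret \<chi>: group_hom \<Gamma> perm_group \<chi> by (rule \<chi>(1))
  obtain h :: "nat word set set \<Rightarrow> complex \<Rightarrow> complex" where h: "group_hom \<Gamma> perm_group h"
    "h (\<sigma> 2) = \<one>\<^bsub>perm_group\<^esub>"
    "\<And>k. h (\<sigma> 0 \<otimes>\<^bsub>\<Gamma>\<^esub> \<sigma> 1) [^]\<^bsub>perm_group\<^esub> (k::nat) = \<one>\<^bsub>perm_group\<^esub> \<longleftrightarrow> 2 ^ s * l1 dvd k"
    "\<And>k. h (\<sigma> 0 \<otimes>\<^bsub>\<Gamma>\<^esub> \<sigma> 1) [^]\<^bsub>perm_group\<^esub> (k::nat) \<noteq> h (\<sigma> 1)"
    by (rule dihedral_hom) blast
  have gens: "\<sigma> i \<in> carrier \<Gamma> \<and> \<sigma> i \<otimes>\<^bsub>\<Gamma>\<^esub> \<sigma> i = \<one>\<^bsub>\<Gamma>\<^esub>" if "i \<in> {0, 1, 2}" for i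
    using that a_closed b_closed c_closed a_sq b_sq c_sq by fastforce
  \<comment> \<open>A trivial generator would make its toggle the identity, but a toggle moves the
    empty set.\<close>
  have ne: "\<sigma> i \<noteq> \<one>\<^bsub>\<Gamma>\<^esub>" if i: "i \<in> {0, 1, 2}" for i
  proof
    assume "\<sigma> i = \<one>\<^bsub>\<Gamma>\<^esub>"
    then have "toggle i = id" using \<chi>(2)[OF i] \<chi>.hom_one by simp
    then have "toggle i {} = {}" by simp
    then show False by (simp add: toggle_def)
  qed
  \<comment> \<open>The rotation and its image under \<open>h\<close> have the same order, so a
    power that dies in the dihedral quotient is already trivial.\<close>
  have faithful: "(\<sigma> 0 \<otimes>\<^bsub>\<Gamma>\<^esub> \<sigma> 1) [^]\<^bsub>\<Gamma>\<^esub> k = \<one>\<^bsub>\<Gamma>\<^esub>"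
    if "h (\<sigma> 0 \<otimes>\<^bsub>\<Gamma>\<^esub> \<sigma> 1) [^]\<^bsub>perm_group\<^esub> k = \<one>\<^bsub>perm_group\<^esub>" for k :: nat
    using that by (simp only: h(3) pow_eq_id[OF m_closed[OF a_closed b_closed]] presented_ords(1))
  have "0 < 2 ^ s * l1" "0 < 2 ^ t * l2" using l1_pos l2_pos by auto
  then have middle: "generate \<Gamma> {\<sigma> 0, \<sigma> 1} \<inter> generate \<Gamma> {\<sigma> 1, \<sigma> 2} \<subseteq> generate \<Gamma> {\<sigma> 1}"
    using middle_intersection[OF h(1,2) faithful h(4) ab_pow _ bc_pow] by blast
  show ?thesis
    unfolding string_C_group_rank3_def
  proof (intro conjI ballI allI impI)
    fix i assume i: "i \<in> {0, 1, 2 :: nat}"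
    show "\<sigma> i \<in> carrier \<Gamma>" "ord (\<sigma> i) = 2"
      using gens[OF i] ne[OF i] ord_involution by blast+
  next
    show "generate \<Gamma> (\<sigma> ` {0, 1, 2}) = carrier \<Gamma>" using generated by simp
    show "\<sigma> 0 \<otimes>\<^bsub>\<Gamma>\<^esub> \<sigma> 2 = \<sigma> 2 \<otimes>\<^bsub>\<Gamma>\<^esub> \<sigma> 0" using ca by simp
    fix I J :: "nat set" assume IJ: "I \<subseteq> {0, 1, 2} \<and> J \<subseteq> {0, 1, 2}"
    show "generate \<Gamma> (\<sigma> ` I) \<inter> generate \<Gamma> (\<sigma> ` J) = generate \<Gamma> (\<sigma> ` (I \<inter> J))"
      by (rule intersection_property[OF gens ca \<chi> middle]) (use IJ in auto)
  qed (rule is_group)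
qed

end

theorem theorem4p1:
  fixes s t n l1 l2 :: nat
  assumes "s \<ge> 2" and "t \<ge> 2" and "n \<ge> s + t + 1"
    and "l1 > 0" and "odd l1" and "l2 > 0" and "odd l2"
  shows "let G = presented_group {0, 1, 2} (relators s t n l1 l2);
             \<rho> = presented_gen {0, 1, 2} (relators s t n l1 l2)
         in solvable G \<and>
            string_C_group_rank3 G \<rho> \<and>
            order G = 2 ^ n * l1 * l2 \<and>
            schlafli_type G \<rho> = (2 ^ s * l1, 2 ^ t * l2)"
  unfolding Let_def
proof (intro conjI)
  show "solvable (presented_group {0, 1, 2} (relators s t n l1 l2))"
    by (rule relators_group.relators_solvable[OF presented_relators_group[OF assms(1,2,4,6)]])
  show "schlafli_type (presented_group {0, 1, 2} (relators s t n l1 l2))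
      (presented_gen {0, 1, 2} (relators s t n l1 l2)) = (2 ^ s * l1, 2 ^ t * l2)"
    unfolding schlafli_type_def by (simp only: presented_ords[OF assms(1,2,4,6)])
qed (rule presented_string_C_group[OF assms(1,2,4,6)] presented_order[OF assms(1,2,4,6,3)])+

end
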